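(* Pick $k>\sqrt{2n}$. Under the non-degeneracy assumption below, for almost all $C$, all non-optimal first-order critical points are unstable fixed points for the Mixing method.
   Context: Let $C\in\mathbb{R}^{n\times n}$ be a symmetric cost matrix with (w.l.o.g.) $c_{ii}=0$. Consider the non-convex problem $\min_{V\in\mathbb{R}^{k\times n}}\langle C,V^TV\rangle$ subject to $\|v_i\|=1$, $i=1,\ldots,n$ ($v_i$ the $i$-th column of $V$, $\|\cdot\|$ the Euclidean norm), which is the low-rank form of the SDP $\min_{X\succeq0}\langle C,X\rangle$ s.t. $X_{ii}=1$. The Mixing method cyclically, for $i=1,\ldots,n$, updates $v_i := -\sum_j c_{ij}v_j/\|\sum_j c_{ij}v_j\|$ using the most recent values. Non-degeneracy assumption: for all $i$, $\|\sum_{j=1}^n c_{ij}v_j\|\ge\delta>0$ throughout the procedure. A critical point $V$ is "non-optimal" if $V^TV$ is not optimal for the SDP; "unstable" means the Jacobian of the Mixing map at $V$ has spectral radius greater than $1$.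
   Formalization: First-order critical points are restricted to those with g_i = −‖g_i‖ v_i for all i, where g_i = Σ_j c_ij v_j; critical points with g_i = +‖g_i‖ v_i for some i are excluded, since under non-degeneracy they are not fixed points of the Mixing method. *)

theory Defs
  imports "HOL-Analysis.Analysis" "Jordan_Normal_Form.Spectral_Radius"
begin

(* Conventions: an n x n cost matrix C is a function nat => nat => real, entries C i j
   for i, j < n.  A k x n matrix V is a function nat => nat => real with V a i the a-th
   coordinate (a < k) of the i-th column v_i (i < n). *)

definition upper_idx :: "nat \<Rightarrow> (nat \<times> nat) set" where
  "upper_idx n = {(i, j). i < j \<and> j < n}"

definition sym_cost :: "(nat \<times> nat \<Rightarrow> real) \<Rightarrow> nat \<Rightarrow> nat \<Rightarrow> real" where
  "sym_cost A i j = (if i = j then 0 else A (min i j, max i j))"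

definition gvec :: "nat \<Rightarrow> (nat \<Rightarrow> nat \<Rightarrow> real) \<Rightarrow> (nat \<Rightarrow> nat \<Rightarrow> real) \<Rightarrow> nat \<Rightarrow> nat \<Rightarrow> real" where
  "gvec n C V i a = (\<Sum>j<n. C i j * V a j)"

definition gnorm :: "nat \<Rightarrow> nat \<Rightarrow> (nat \<Rightarrow> nat \<Rightarrow> real) \<Rightarrow> (nat \<Rightarrow> nat \<Rightarrow> real) \<Rightarrow> nat \<Rightarrow> real" where
  "gnorm n k C V i = sqrt (\<Sum>a<k. (gvec n C V i a)\<^sup>2)"

definition unit_columns :: "nat \<Rightarrow> nat \<Rightarrow> (nat \<Rightarrow> nat \<Rightarrow> real) \<Rightarrow> bool" where
  "unit_columns n k V \<longleftrightarrow> (\<forall>i<n. sqrt (\<Sum>a<k. (V a i)\<^sup>2) = 1)"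

definition mix_step :: "nat \<Rightarrow> nat \<Rightarrow> (nat \<Rightarrow> nat \<Rightarrow> real) \<Rightarrow> nat \<Rightarrow> (nat \<Rightarrow> nat \<Rightarrow> real) \<Rightarrow> (nat \<Rightarrow> nat \<Rightarrow> real)" where
  "mix_step n k C i V = (\<lambda>a j. if j = i \<and> a < k then - gvec n C V i a / gnorm n k C V i else V a j)"

definition mix_partial :: "nat \<Rightarrow> nat \<Rightarrow> (nat \<Rightarrow> nat \<Rightarrow> real) \<Rightarrow> nat \<Rightarrow> (nat \<Rightarrow> nat \<Rightarrow> real) \<Rightarrow> (nat \<Rightarrow> nat \<Rightarrow> real)" where
  "mix_partial n k C m V = fold (mix_step n k C) [0..<m] V"

definition mixing_map :: "nat \<Rightarrow> nat \<Rightarrow> (nat \<Rightarrow> nat \<Rightarrow> real) \<Rightarrow> (nat \<Rightarrow> nat \<Rightarrow> real) \<Rightarrow> (nat \<Rightarrow> nat \<Rightarrow> real)" where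
  "mixing_map n k C V = mix_partial n k C n V"

definition nondegenerate :: "nat \<Rightarrow> nat \<Rightarrow> (nat \<Rightarrow> nat \<Rightarrow> real) \<Rightarrow> (nat \<Rightarrow> nat \<Rightarrow> real) \<Rightarrow> bool" where
  "nondegenerate n k C V \<longleftrightarrow>
     (\<exists>\<delta>>0. \<forall>i<n. gnorm n k C (mix_partial n k C i V) i \<ge> \<delta>)"

text \<open>First-order critical point of min <C, V^T V> s.t. norm v_i = 1: the KKT condition
  g_i = y_i v_i with multiplier y_i = - norm g_i, i.e. v_i = - g_i / norm g_i.\<close>
definition first_order_critical :: "nat \<Rightarrow> nat \<Rightarrow> (nat \<Rightarrow> nat \<Rightarrow> real) \<Rightarrow> (nat \<Rightarrow> nat \<Rightarrow> real) \<Rightarrow> bool" where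
  "first_order_critical n k C V \<longleftrightarrow> unit_columns n k V \<and>
     (\<forall>i<n. \<forall>a<k. gvec n C V i a = - gnorm n k C V i * V a i)"

definition gram :: "nat \<Rightarrow> (nat \<Rightarrow> nat \<Rightarrow> real) \<Rightarrow> nat \<Rightarrow> nat \<Rightarrow> real" where
  "gram k V i j = (\<Sum>a<k. V a i * V a j)"

definition frob_inner :: "nat \<Rightarrow> (nat \<Rightarrow> nat \<Rightarrow> real) \<Rightarrow> (nat \<Rightarrow> nat \<Rightarrow> real) \<Rightarrow> real" where
  "frob_inner n C X = (\<Sum>i<n. \<Sum>j<n. C i j * X i j)"

definition psd :: "nat \<Rightarrow> (nat \<Rightarrow> nat \<Rightarrow> real) \<Rightarrow> bool" where
  "psd n X \<longleftrightarrow> (\<forall>i<n. \<forall>j<n. X i j = X j i) \<and>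
     (\<forall>x :: nat \<Rightarrow> real. (\<Sum>i<n. \<Sum>j<n. x i * X i j * x j) \<ge> 0)"

definition sdp_feasible :: "nat \<Rightarrow> (nat \<Rightarrow> nat \<Rightarrow> real) \<Rightarrow> bool" where
  "sdp_feasible n X \<longleftrightarrow> psd n X \<and> (\<forall>i<n. X i i = 1)"

definition sdp_optimal :: "nat \<Rightarrow> (nat \<Rightarrow> nat \<Rightarrow> real) \<Rightarrow> (nat \<Rightarrow> nat \<Rightarrow> real) \<Rightarrow> bool" where
  "sdp_optimal n C X \<longleftrightarrow> sdp_feasible n X \<and>
     (\<forall>Y. sdp_feasible n Y \<longrightarrow> frob_inner n C X \<le> frob_inner n C Y)"

definition perturb :: "(nat \<Rightarrow> nat \<Rightarrow> real) \<Rightarrow> nat \<Rightarrow> nat \<Rightarrow> real \<Rightarrow> (nat \<Rightarrow> nat \<Rightarrow> real)" where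
  "perturb V b j t = (\<lambda>b' j'. V b' j' + (if b' = b \<and> j' = j then t else 0))"

definition mixing_jacobian :: "nat \<Rightarrow> nat \<Rightarrow> (nat \<Rightarrow> nat \<Rightarrow> real) \<Rightarrow> (nat \<Rightarrow> nat \<Rightarrow> real) \<Rightarrow> real mat" where
  "mixing_jacobian n k C V = Matrix.mat (k * n) (k * n) (\<lambda>(p, q).
      deriv (\<lambda>t. mixing_map n k C (perturb V (q div n) (q mod n) t) (p div n) (p mod n)) 0)"

definition unstable_fixed_point :: "nat \<Rightarrow> nat \<Rightarrow> (nat \<Rightarrow> nat \<Rightarrow> real) \<Rightarrow> (nat \<Rightarrow> nat \<Rightarrow> real) \<Rightarrow> bool" where
  "unstable_fixed_point n k C V \<longleftrightarrow> mixing_map n k C V = V \<and>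
     spectral_radius (map_mat complex_of_real (mixing_jacobian n k C V)) > 1"

end

theory Submission
  imports Defs
begin

text \<open>
  Put \<open>y\<^sub>i = \<parallel>g\<^sub>i\<parallel>\<close> and \<open>S = C + diag(y)\<close>. A critical \<open>V\<close> satisfies \<open>S V\<^sup>T = 0\<close>, so if \<open>V\<close> has
  rank \<open>k\<close> then \<open>S\<close> has corank at least \<open>k\<close>. Symmetric matrices of corank at least \<open>k\<close> are
  parametrized polynomially by \<open>n(n+1)/2 - k(k+1)/2\<close> numbers, fewer than the \<open>n(n-1)/2\<close>
  off-diagonal entries of \<open>C\<close> as soon as \<open>k(k+1) > 2n\<close>; hence for almost all \<open>C\<close> every critical
  point is rank deficient and some \<open>u \<noteq> 0\<close> is orthogonal to all columns of \<open>V\<close>.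

  In the directions \<open>u x\<^sup>T\<close> the normalization does not contribute to first order, and the Jacobian
  of the Mixing map acts on \<open>x\<close> as one Gauss--Seidel sweep for \<open>S\<close>. If \<open>V\<close> is not optimal, then
  \<open>S\<close> is not positive semidefinite. A sweep lowers \<open>x\<^sup>T S x\<close> by at least a fixed fraction of its
  absolute value, so a start with \<open>x\<^sup>T S x < 0\<close> makes the iterates grow geometrically, whereas a
  spectral radius at most \<open>1\<close> would allow only polynomial growth.
\<close>

section \<open>Locally Lipschitz images of lower dimension\<close>

text \<open>Lipschitz continuity on every box of radius \<open>R\<close>, measured in the sup
  distance over \<open>P\<close>. The distance enters only through an upper bound
  \<open>\<delta>\<close>, so an empty \<open>P\<close> needs no special case. Quantifying over
  boxes makes the class closed under products, so polynomials in the coordinates from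
  \<open>P\<close> belong to it.\<close>

definition locally_lipschitz :: "'i set \<Rightarrow> (('i \<Rightarrow> real) \<Rightarrow> real) \<Rightarrow> bool" where
  "locally_lipschitz P f \<longleftrightarrow>
     (\<forall>R. \<exists>L\<ge>0. \<forall>s t \<delta>. (\<forall>i\<in>P. \<bar>s i\<bar> \<le> R \<and> \<bar>t i\<bar> \<le> R \<and> \<bar>s i - t i\<bar> \<le> \<delta>) \<longrightarrow> 0 \<le> \<delta> \<longrightarrow> \<bar>f s - f t\<bar> \<le> L * \<delta>)"

lemma locally_lipschitz_bounded:
  assumes "locally_lipschitz P f" "0 \<le> R"
  shows "\<exists>B\<ge>0. \<forall>s. (\<forall>i\<in>P. \<bar>s i\<bar> \<le> R) \<longrightarrow> \<bar>f s\<bar> \<le> B"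
proof -
  obtain L where "L \<ge> 0" and L: "\<And>s t \<delta>. (\<forall>i\<in>P. \<bar>s i\<bar> \<le> R \<and> \<bar>t i\<bar> \<le> R \<and> \<bar>s i - t i\<bar> \<le> \<delta>) \<Longrightarrow> 0 \<le> \<delta> \<Longrightarrow> \<bar>f s - f t\<bar> \<le> L * \<delta>"
    using assms(1) unfolding locally_lipschitz_def by meson
  have "\<bar>f s\<bar> \<le> \<bar>f (\<lambda>_. 0)\<bar> + L * R" if "\<forall>i\<in>P. \<bar>s i\<bar> \<le> R" for s
    using L[of s "\<lambda>_. 0" R] that assms(2) by force
  then show ?thesis
    using \<open>L \<ge> 0\<close> assms(2) by (intro exI[of _ "\<bar>f (\<lambda>_. 0)\<bar> + L * R"]) auto
qed

lemma locally_lipschitz_const: "locally_lipschitz P (\<lambda>s. c)"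
  unfolding locally_lipschitz_def by (auto intro!: exI[of _ 0])

lemma locally_lipschitz_coord: "i \<in> P \<Longrightarrow> locally_lipschitz P (\<lambda>s. s i)"
  unfolding locally_lipschitz_def by (auto intro!: exI[of _ 1])

lemma locally_lipschitz_uminus:
  assumes "locally_lipschitz P f"
  shows "locally_lipschitz P (\<lambda>s. - f s)"
  using assms unfolding locally_lipschitz_def by (simp add: abs_minus_commute)

lemma locally_lipschitz_add:
  assumes f: "locally_lipschitz P f" and g: "locally_lipschitz P g"
  shows "locally_lipschitz P (\<lambda>s. f s + g s)"
  unfolding locally_lipschitz_def
proof
  fix R
  obtain L where L: "L \<ge> 0" "\<And>s t \<delta>. (\<forall>i\<in>P. \<bar>s i\<bar> \<le> R \<and> \<bar>t i\<bar> \<le> R \<and> \<bar>s i - t i\<bar> \<le> \<delta>) \<Longrightarrow> 0 \<le> \<delta> \<Longrightarrow> \<bar>f s - f t\<bar> \<le> L * \<delta>"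
    using f unfolding locally_lipschitz_def by meson
  obtain L' where L': "L' \<ge> 0" "\<And>s t \<delta>. (\<forall>i\<in>P. \<bar>s i\<bar> \<le> R \<and> \<bar>t i\<bar> \<le> R \<and> \<bar>s i - t i\<bar> \<le> \<delta>) \<Longrightarrow> 0 \<le> \<delta> \<Longrightarrow> \<bar>g s - g t\<bar> \<le> L' * \<delta>"
    using g unfolding locally_lipschitz_def by meson
  have "\<bar>f s + g s - (f t + g t)\<bar> \<le> (L + L') * \<delta>"
    if "\<forall>i\<in>P. \<bar>s i\<bar> \<le> R \<and> \<bar>t i\<bar> \<le> R \<and> \<bar>s i - t i\<bar> \<le> \<delta>" "0 \<le> \<delta>" for s t \<delta>
    using L(2)[OF that] L'(2)[OF that] by (simp add: distrib_right)
  then show "\<exists>L\<ge>0. \<forall>s t \<delta>. (\<forall>i\<in>P. \<bar>s i\<bar> \<le> R \<and> \<bar>t i\<bar> \<le> R \<and> \<bar>s i - t i\<bar> \<le> \<delta>) \<longrightarrow> 0 \<le> \<delta> \<longrightarrow> \<bar>f s + g s - (f t + g t)\<bar> \<le> L * \<delta>"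
    using L(1) L'(1) by (intro exI[of _ "L + L'"]) auto
qed

lemma locally_lipschitz_sum:
  assumes "\<And>i. i \<in> S \<Longrightarrow> locally_lipschitz P (f i)"
  shows "locally_lipschitz P (\<lambda>s. \<Sum>i\<in>S. f i s)"
  using assms
  by (induction S rule: infinite_finite_induct)
     (simp_all add: locally_lipschitz_const locally_lipschitz_add)

lemma locally_lipschitz_mult:
  assumes f: "locally_lipschitz P f" and g: "locally_lipschitz P g"
  shows "locally_lipschitz P (\<lambda>s. f s * g s)"
  unfolding locally_lipschitz_def
proof
  fix R0 :: real
  \<comment> \<open>\<open>R0\<close> may be negative, while boundedness of the factors on a box is
    available only for a nonnegative radius.\<close>
  define R where "R = \<bar>R0\<bar>"
  obtain L where L: "L \<ge> 0" "\<And>s t \<delta>. (\<forall>i\<in>P. \<bar>s i\<bar> \<le> R \<and> \<bar>t i\<bar> \<le> R \<and> \<bar>s i - t i\<bar> \<le> \<delta>) \<Longrightarrow> 0 \<le> \<delta> \<Longrightarrow> \<bar>f s - f t\<bar> \<le> L * \<delta>"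
    using f unfolding locally_lipschitz_def by meson
  obtain L' where L': "L' \<ge> 0" "\<And>s t \<delta>. (\<forall>i\<in>P. \<bar>s i\<bar> \<le> R \<and> \<bar>t i\<bar> \<le> R \<and> \<bar>s i - t i\<bar> \<le> \<delta>) \<Longrightarrow> 0 \<le> \<delta> \<Longrightarrow> \<bar>g s - g t\<bar> \<le> L' * \<delta>"
    using g unfolding locally_lipschitz_def by meson
  obtain B where B: "B \<ge> 0" "\<And>s. (\<forall>i\<in>P. \<bar>s i\<bar> \<le> R) \<Longrightarrow> \<bar>f s\<bar> \<le> B"
    using locally_lipschitz_bounded[OF f, of R] R_def by auto
  obtain B' where B': "B' \<ge> 0" "\<And>s. (\<forall>i\<in>P. \<bar>s i\<bar> \<le> R) \<Longrightarrow> \<bar>g s\<bar> \<le> B'"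
    using locally_lipschitz_bounded[OF g, of R] R_def by auto
  have "\<bar>f s * g s - f t * g t\<bar> \<le> (B * L' + B' * L) * \<delta>"
    if st: "\<forall>i\<in>P. \<bar>s i\<bar> \<le> R0 \<and> \<bar>t i\<bar> \<le> R0 \<and> \<bar>s i - t i\<bar> \<le> \<delta>" and d: "0 \<le> \<delta>" for s t \<delta>
  proof -
    have st: "\<forall>i\<in>P. \<bar>s i\<bar> \<le> R \<and> \<bar>t i\<bar> \<le> R \<and> \<bar>s i - t i\<bar> \<le> \<delta>"
      using st unfolding R_def by force
    have "f s * g s - f t * g t = f s * (g s - g t) + g t * (f s - f t)"
      by (simp add: algebra_simps)
    also have "\<bar>\<dots>\<bar> \<le> \<bar>f s\<bar> * \<bar>g s - g t\<bar> + \<bar>g t\<bar> * \<bar>f s - f t\<bar>"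
      by (metis abs_mult abs_triangle_ineq)
    also have "\<dots> \<le> B * (L' * \<delta>) + B' * (L * \<delta>)"
      using B B' L(2)[OF st d] L'(2)[OF st d] st by (intro add_mono mult_mono) auto
    finally show ?thesis by (simp add: algebra_simps)
  qed
  then show "\<exists>L\<ge>0. \<forall>s t \<delta>. (\<forall>i\<in>P. \<bar>s i\<bar> \<le> R0 \<and> \<bar>t i\<bar> \<le> R0 \<and> \<bar>s i - t i\<bar> \<le> \<delta>) \<longrightarrow> 0 \<le> \<delta> \<longrightarrow> \<bar>f s * g s - f t * g t\<bar> \<le> L * \<delta>"
    using L(1) L'(1) B(1) B'(1) by (intro exI[of _ "B * L' + B' * L"]) auto
qed

text \<open>Covering argument: a grid of mesh \<open>1/m\<close> in the box has
  \<open>O(m ^ card P)\<close> points, and cubes of side \<open>2 * L / m\<close> around their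
  images cover the image of the box. Their total measure is
  \<open>O(m ^ card P / m ^ card K)\<close>, which tends to 0. The image is only enclosed in a null
  set, so its own measurability need not be shown.\<close>

lemma lowdim_box_image_null:
  fixes F :: "('i \<Rightarrow> real) \<Rightarrow> 'k \<Rightarrow> real" and R :: nat
  assumes P: "finite P" and K: "finite K" and card: "card P < card K"
    and lip: "\<And>\<kappa>. \<kappa> \<in> K \<Longrightarrow> locally_lipschitz P (\<lambda>s. F s \<kappa>)"
  shows "\<exists>N\<in>null_sets (PiM K (\<lambda>_. lborel)).
    {A \<in> space (PiM K (\<lambda>_. lborel)). \<exists>s. (\<forall>i\<in>P. \<bar>s i\<bar> \<le> real R) \<and> (\<forall>\<kappa>\<in>K. A \<kappa> = F s \<kappa>)} \<subseteq> N"
proof -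
  interpret product_sigma_finite "\<lambda>_::'k. lborel :: real measure" ..
  interpret finite_product_sigma_finite "\<lambda>_::'k. lborel :: real measure" K
    by standard (rule K)
  let ?M = "PiM K (\<lambda>_. lborel :: real measure)"
  have "\<forall>\<kappa>\<in>K. \<exists>L\<ge>0. \<forall>s t \<delta>. (\<forall>i\<in>P. \<bar>s i\<bar> \<le> real R \<and> \<bar>t i\<bar> \<le> real R \<and> \<bar>s i - t i\<bar> \<le> \<delta>) \<longrightarrow> 0 \<le> \<delta> \<longrightarrow> \<bar>F s \<kappa> - F t \<kappa>\<bar> \<le> L * \<delta>"
    using lip unfolding locally_lipschitz_def by blast
  then obtain \<Lambda> where \<Lambda>0: "\<And>\<kappa>. \<kappa> \<in> K \<Longrightarrow> \<Lambda> \<kappa> \<ge> 0"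
    and \<Lambda>: "\<And>\<kappa> s t \<delta>. \<kappa> \<in> K \<Longrightarrow> (\<forall>i\<in>P. \<bar>s i\<bar> \<le> real R \<and> \<bar>t i\<bar> \<le> real R \<and> \<bar>s i - t i\<bar> \<le> \<delta>) \<Longrightarrow> 0 \<le> \<delta> \<Longrightarrow> \<bar>F s \<kappa> - F t \<kappa>\<bar> \<le> \<Lambda> \<kappa> * \<delta>"
    by metis
  define L where "L = (\<Sum>\<kappa>\<in>K. \<Lambda> \<kappa>)"
  have L0: "L \<ge> 0" unfolding L_def by (simp add: \<Lambda>0 sum_nonneg)
  have \<Lambda>L: "\<Lambda> \<kappa> \<le> L" if "\<kappa> \<in> K" for \<kappa>
    unfolding L_def using that K \<Lambda>0 by (intro member_le_sum) auto
  \<comment> \<open>Integer functions \<open>g\<close> encode the grid points \<open>g / m\<close>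
    of the box; \<open>Q m g\<close> is the cube around the image of such a point.\<close>
  define G where "G m = (P \<rightarrow>\<^sub>E {- int R * int m .. int R * int m})" for m
  define Q where "Q m g = (\<Pi>\<^sub>E \<kappa>\<in>K. {F (\<lambda>i. real_of_int (g i) / real m) \<kappa> - L / real m .. F (\<lambda>i. real_of_int (g i) / real m) \<kappa> + L / real m})"
    for m :: nat and g :: "'i \<Rightarrow> int"
  define N where "N = (\<Inter>m\<in>{1..}. \<Union>g\<in>G m. Q m g)"
  have finG: "finite (G m)" for m
    unfolding G_def using P by (intro finite_PiE) auto
  have cardG: "card (G m) = (2 * R * m + 1) ^ card P" for m
  proof -
    have "nat (int R * int m + 1 - (- int R * int m)) = 2 * R * m + 1"
      by (simp add: nat_eq_iff) 
    then show ?thesis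
      unfolding G_def using P by (simp add: card_PiE)
  qed
  have Qs: "Q m g \<in> sets ?M" for m g
    unfolding Q_def using K by (intro sets_PiM_I_finite) auto
  have Qm: "emeasure ?M (Q m g) = ennreal ((2 * L / real m) ^ card K)" for m g
  proof -
    have "emeasure ?M (Q m g) = (\<Prod>\<kappa>\<in>K. ennreal (2 * L / real m))"
      unfolding Q_def using L0 by (subst emeasure_PiM) (use K in \<open>auto intro!: prod.cong\<close>)
    also have "\<dots> = ennreal ((2 * L / real m) ^ card K)"
      using L0 by (simp add: ennreal_power)
    finally show ?thesis .
  qed
  have Us: "(\<Union>g\<in>G m. Q m g) \<in> sets ?M" for m
    using finG Qs by auto
  then have Ns: "N \<in> sets ?M"
    unfolding N_def by (intro sets.countable_INT') auto
  define c where "c = (2 * real R + 1) ^ card P * (2 * L) ^ card K"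
  have Nm: "emeasure ?M N \<le> ennreal (c / real m)" if m: "m \<ge> 1" for m
  proof -
    have "emeasure ?M N \<le> emeasure ?M (\<Union>g\<in>G m. Q m g)"
      using m Us by (intro emeasure_mono) (auto simp: N_def)
    also have "\<dots> \<le> (\<Sum>g\<in>G m. emeasure ?M (Q m g))"
      using finG Qs by (intro emeasure_subadditive_finite) auto
    also have "\<dots> = ennreal (real ((2 * R * m + 1) ^ card P) * (2 * L / real m) ^ card K)"
      using L0 by (simp add: Qm cardG ennreal_mult ennreal_of_nat_eq_real_of_nat)
    also have "\<dots> \<le> ennreal (c / real m)"
    proof (rule ennreal_leI)
      have "real ((2 * R * m + 1) ^ card P) \<le> ((2 * real R + 1) * real m) ^ card P"
        unfolding of_nat_power using m by (intro power_mono) (auto simp: algebra_simps)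
      then have "real ((2 * R * m + 1) ^ card P) * (2 * L / real m) ^ card K
          \<le> ((2 * real R + 1) * real m) ^ card P * (2 * L / real m) ^ card K"
        using L0 by (intro mult_right_mono) auto
      also have "\<dots> = c * (real m ^ card P / real m ^ card K)"
        unfolding c_def by (simp add: power_mult_distrib power_divide)
      also have "\<dots> \<le> c * (1 / real m)"
      proof (rule mult_left_mono)
        \<comment> \<open>The strict inequality \<open>card P < card K\<close> leaves one spare
          power of \<open>m\<close>.\<close>
        have "real m ^ Suc (card P) \<le> real m ^ card K"
          using m card by (intro power_increasing) auto
        then show "real m ^ card P / real m ^ card K \<le> 1 / real m"
          using m by (simp add: field_simps)
        show "0 \<le> c" unfolding c_def using L0 by auto
      qed
      finally show "real ((2 * R * m + 1) ^ card P) * (2 * L / real m) ^ card K \<le> c / real m"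
        by simp
    qed
    finally show ?thesis .
  qed
  have "(\<lambda>m. ennreal (c / real m)) \<longlonglongrightarrow> ennreal 0"
    by (intro tendsto_ennrealI lim_const_over_n)
  then have "emeasure ?M N \<le> 0"
    using Nm by (intro LIMSEQ_le_const[where X = "\<lambda>m. ennreal (c / real m)"]) auto
  then have "N \<in> null_sets ?M"
    using Ns by auto
  moreover have "A \<in> N" if A: "A \<in> space ?M" and s: "\<forall>i\<in>P. \<bar>s i\<bar> \<le> real R" "\<forall>\<kappa>\<in>K. A \<kappa> = F s \<kappa>" for A s
    unfolding N_def
  proof
    fix m :: nat assume "m \<in> {1..}"
    then have m: "real m > 0" by simp
    \<comment> \<open>Rounding down to the grid moves each coordinate by at most \<open>1/m\<close>;
      the rounded point stays in the box because \<open>R * m\<close> is an integer.\<close>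
    define g where "g = (\<lambda>i\<in>P. \<lfloor>s i * real m\<rfloor>)"
    have gi: "g i = \<lfloor>s i * real m\<rfloor>" if "i \<in> P" for i using that by (simp add: g_def)
    have bnd: "- int R * int m \<le> g i \<and> g i \<le> int R * int m" if "i \<in> P" for i
    proof -
      have si: "- real R \<le> s i" "s i \<le> real R" using s(1) that by (auto simp: abs_le_iff)
      have "real_of_int (- int R * int m) \<le> s i * real m"
        using mult_right_mono[OF si(1), of "real m"] by simp
      moreover have "s i * real m \<le> real_of_int (int R * int m)"
        using mult_right_mono[OF si(2), of "real m"] by simp
      ultimately show ?thesis
        unfolding gi[OF that] by (metis floor_mono floor_of_int)
    qed
    then have gG: "g \<in> G m" unfolding G_def by (auto simp: g_def)
    have "\<bar>s i\<bar> \<le> real R \<and> \<bar>real_of_int (g i) / real m\<bar> \<le> real R \<and> \<bar>s i - real_of_int (g i) / real m\<bar> \<le> 1 / real m" if "i \<in> P" for i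
    proof -
      have "real_of_int (- int R * int m) \<le> real_of_int (g i)" "real_of_int (g i) \<le> real_of_int (int R * int m)"
        using bnd[OF that] by linarith+
      then have "\<bar>real_of_int (g i)\<bar> \<le> real R * real m" by auto
      then have "\<bar>real_of_int (g i) / real m\<bar> \<le> real R"
        using m by (simp add: pos_divide_le_eq abs_divide)
      moreover have "\<bar>s i * real m - real_of_int (g i)\<bar> \<le> 1"
        unfolding gi[OF that] by linarith
      then have "\<bar>(s i - real_of_int (g i) / real m) * real m\<bar> \<le> 1"
        using m by (simp add: left_diff_distrib)
      then have "\<bar>s i - real_of_int (g i) / real m\<bar> \<le> 1 / real m"
        using m by (simp add: abs_mult pos_le_divide_eq)
      ultimately show ?thesis using s(1) that by auto
    qed
    then have "\<bar>F s \<kappa> - F (\<lambda>i. real_of_int (g i) / real m) \<kappa>\<bar> \<le> \<Lambda> \<kappa> * (1 / real m)" if "\<kappa> \<in> K" for \<kappa>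
      using \<Lambda>[OF that, of s "\<lambda>i. real_of_int (g i) / real m" "1 / real m"] by auto
    moreover have "\<Lambda> \<kappa> * (1 / real m) \<le> L / real m" if "\<kappa> \<in> K" for \<kappa>
      using \<Lambda>L[OF that] m by (simp add: divide_right_mono)
    ultimately have "\<bar>A \<kappa> - F (\<lambda>i. real_of_int (g i) / real m) \<kappa>\<bar> \<le> L / real m" if "\<kappa> \<in> K" for \<kappa>
      using s(2) that by (metis order_trans)
    then have "A \<kappa> \<in> {F (\<lambda>i. real_of_int (g i) / real m) \<kappa> - L / real m .. F (\<lambda>i. real_of_int (g i) / real m) \<kappa> + L / real m}" if "\<kappa> \<in> K" for \<kappa>
      using that by (auto simp: abs_diff_le_iff)
    moreover have "A \<in> extensional K"
      using A by (simp add: space_PiM PiE_iff)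
    ultimately have "A \<in> Q m g"
      unfolding Q_def PiE_iff by blast
    then show "A \<in> (\<Union>g\<in>G m. Q m g)" using gG by auto
  qed
  ultimately show ?thesis by (intro bexI[of _ N]) auto
qed

text \<open>Since \<open>P\<close> is finite, every parameter vector lies in a box of integer
  radius, and countably many null sets have a null union.\<close>

lemma lowdim_image_null:
  fixes F :: "('i \<Rightarrow> real) \<Rightarrow> 'k \<Rightarrow> real"
  assumes P: "finite P" and K: "finite K" and card: "card P < card K"
    and lip: "\<And>\<kappa>. \<kappa> \<in> K \<Longrightarrow> locally_lipschitz P (\<lambda>s. F s \<kappa>)"
  shows "AE A in PiM K (\<lambda>_. lborel). \<not> (\<exists>s. \<forall>\<kappa>\<in>K. A \<kappa> = F s \<kappa>)"
proof -
  let ?M = "PiM K (\<lambda>_. lborel :: real measure)"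
  have "AE A in ?M. \<not> (\<exists>s. (\<forall>i\<in>P. \<bar>s i\<bar> \<le> real R) \<and> (\<forall>\<kappa>\<in>K. A \<kappa> = F s \<kappa>))" for R :: nat
  proof -
    obtain N where "N \<in> null_sets ?M"
      "{A \<in> space ?M. \<exists>s. (\<forall>i\<in>P. \<bar>s i\<bar> \<le> real R) \<and> (\<forall>\<kappa>\<in>K. A \<kappa> = F s \<kappa>)} \<subseteq> N"
      using lowdim_box_image_null[of P K F R, OF assms] by blast
    then show ?thesis by (intro AE_I') auto
  qed
  then have "AE A in ?M. \<forall>R::nat. \<not> (\<exists>s. (\<forall>i\<in>P. \<bar>s i\<bar> \<le> real R) \<and> (\<forall>\<kappa>\<in>K. A \<kappa> = F s \<kappa>))"
    by (simp add: AE_all_countable)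
  then show ?thesis
  proof eventually_elim
    case (elim A)
    have "\<exists>R::nat. \<forall>i\<in>P. \<bar>s i\<bar> \<le> real R" for s :: "'i \<Rightarrow> real"
    proof -
      obtain R :: nat where R: "(\<Sum>i\<in>P. \<bar>s i\<bar>) \<le> real R" using real_arch_simple by blast
      have "\<bar>s i\<bar> \<le> real R" if "i \<in> P" for i
        using member_le_sum[of i P "\<lambda>i. \<bar>s i\<bar>"] that P R by auto
      then show ?thesis by auto
    qed
    then show ?case using elim by blast
  qed
qed

section \<open>Dual certificates\<close>

lemma psd_diag_nonneg:
  assumes "psd n S" "i < n"
  shows "S i i \<ge> 0"
proof -
  define x where "x l = (if l = i then 1 else 0 :: real)" for l
  have "(\<Sum>a<n. \<Sum>b<n. x a * S a b * x b) = (\<Sum>a<n. x a * S a i)"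
    using assms(2) by (intro sum.cong refl) (simp add: x_def if_distrib cong: if_cong)
  also have "\<dots> = S i i"
    using assms(2) by (simp add: x_def if_distrib[of "\<lambda>z. z * _"] cong: if_cong)
  finally have "(\<Sum>a<n. \<Sum>b<n. x a * S a b * x b) = S i i" .
  moreover have "(\<Sum>a<n. \<Sum>b<n. x a * S a b * x b) \<ge> 0"
    using assms(1) by (simp add: psd_def)
  ultimately show ?thesis by simp
qed

lemma psd_quad_Suc:
  fixes S :: "nat \<Rightarrow> nat \<Rightarrow> real"
  assumes sym: "\<forall>i<Suc n. \<forall>j<Suc n. S i j = S j i"
  shows "(\<Sum>i<Suc n. \<Sum>j<Suc n. x i * S i j * x j)
    = (\<Sum>i<n. \<Sum>j<n. x i * S i j * x j) + 2 * x n * (\<Sum>i<n. S i n * x i) + S n n * (x n)\<^sup>2"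
proof -
  have "(\<Sum>j<n. x n * S n j * x j) = x n * (\<Sum>i<n. S i n * x i)"
    unfolding sum_distrib_left using sym by (intro sum.cong) auto
  moreover have "(\<Sum>i<n. x i * S i n * x n) = x n * (\<Sum>i<n. S i n * x i)"
    unfolding sum_distrib_left by (intro sum.cong) auto
  ultimately show ?thesis
    by (simp add: sum.distrib power2_eq_square)
qed

text \<open>Evaluation at the minimizer \<open>- b / q\<close>; this yields the positivity of a
  Schur complement.\<close>

lemma quad_nonneg_at:
  fixes q b c :: real
  assumes "\<And>t. q * t\<^sup>2 + 2 * b * t + c \<ge> 0" "q > 0"
  shows "c - b\<^sup>2 / q \<ge> 0"
proof -
  have "q * (- b / q)\<^sup>2 + 2 * b * (- b / q) + c = c - b\<^sup>2 / q"
    using assms(2) by (simp add: field_simps power2_eq_square)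
  then show ?thesis using assms(1)[of "- b / q"] by simp
qed

lemma linear_nonneg_zero:
  fixes b c :: real
  assumes "\<And>t. 2 * b * t + c \<ge> 0"
  shows "b = 0"
proof (rule ccontr)
  assume "b \<noteq> 0"
  then have "2 * b * (- (c + 1) / (2 * b)) + c = - 1" by simp
  then show False using assms[of "- (c + 1) / (2 * b)"] by simp
qed

text \<open>Induction on the size, splitting off the last row and column. If the last diagonal entry
  is positive, the Schur complement is again positive semidefinite and the subtracted rank-one
  matrix supplies the factor with index \<open>n\<close>. If it is 0, the whole last column vanishes
  and the leading block is factored as it is.\<close>

lemma psd_cholesky:
  assumes "psd n S"
  shows "\<exists>w. \<forall>i<n. \<forall>j<n. S i j = (\<Sum>r<n. w r i * w r j)"
  using assms
proof (induction n arbitrary: S)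
  case 0
  then show ?case by simp
next
  case (Suc n)
  have sym: "\<forall>i<Suc n. \<forall>j<Suc n. S i j = S j i"
    and pos: "\<And>x. (\<Sum>i<Suc n. \<Sum>j<Suc n. x i * S i j * x j) \<ge> 0"
    using Suc.prems unfolding psd_def by auto
  have pos': "S n n * t\<^sup>2 + 2 * (\<Sum>i<n. S i n * x i) * t + (\<Sum>i<n. \<Sum>j<n. x i * S i j * x j) \<ge> 0" for x t
  proof -
    have "(\<Sum>i<n. \<Sum>j<n. (x(n := t)) i * S i j * (x(n := t)) j) = (\<Sum>i<n. \<Sum>j<n. x i * S i j * x j)"
      "(\<Sum>i<n. S i n * (x(n := t)) i) = (\<Sum>i<n. S i n * x i)"
      by (auto intro!: sum.cong)
    then show ?thesis
      using pos[of "x(n := t)"] unfolding psd_quad_Suc[OF sym] by (simp add: mult_ac)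
  qed
  show ?case
  proof (cases "S n n = 0")
    case True
    \<comment> \<open>At the vector with entry 1 at \<open>j\<close>, entry \<open>t\<close> at
      \<open>n\<close> and 0 elsewhere the form is affine in \<open>t\<close>, so nonnegativity
      forces its slope to vanish.\<close>
    have z: "S j n = 0" if "j < n" for j
    proof -
      have "(\<Sum>i<n. S i n * (if i = j then 1 else 0)) = S j n"
        using that by (simp add: if_distrib cong: if_cong)
      then have "2 * S j n * t + (\<Sum>i<n. \<Sum>l<n. (if i = j then 1 else 0) * S i l * (if l = j then 1 else 0)) \<ge> 0" for t
        using pos'[where x = "\<lambda>i. if i = j then 1 else 0" and t = t] True by simp
      then show ?thesis by (rule linear_nonneg_zero)
    qed
    have "psd n S"
      unfolding psd_def using sym pos'[of 0] by auto
    then obtain w where w: "\<forall>i<n. \<forall>j<n. S i j = (\<Sum>r<n. w r i * w r j)"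
      using Suc.IH by blast
    define w' where "w' r i = (if r = n \<or> i = n then 0 else w r i)" for r i
    have "S i j = (\<Sum>r<Suc n. w' r i * w' r j)" if "i < Suc n" "j < Suc n" for i j
    proof (cases "i = n \<or> j = n")
      case True
      then have "S i j = 0" using z sym that \<open>S n n = 0\<close> by (metis lessI less_antisym)
      then show ?thesis using True by (auto simp: w'_def)
    next
      case False
      then have "i < n" "j < n" using that by auto
      then show ?thesis using w by (simp add: w'_def)
    qed
    then show ?thesis by blast
  next
    case False
    then have q: "S n n > 0"
      using psd_diag_nonneg[OF Suc.prems, of n] by simp
    define S' where "S' i j = S i j - S i n * S j n / S n n" for i j
    have "(\<Sum>i<n. \<Sum>j<n. x i * S' i j * x j) \<ge> 0" for x
    proof -
      have "(\<Sum>i<n. \<Sum>j<n. x i * S' i j * x j)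
        = (\<Sum>i<n. \<Sum>j<n. x i * S i j * x j) - (\<Sum>i<n. \<Sum>j<n. (S i n * x i) * (S j n * x j) / S n n)"
        unfolding sum_subtractf[symmetric] S'_def by (simp add: algebra_simps)
      also have "(\<Sum>i<n. \<Sum>j<n. (S i n * x i) * (S j n * x j) / S n n) = (\<Sum>i<n. S i n * x i)\<^sup>2 / S n n"
        unfolding power2_eq_square sum_product by (simp add: sum_divide_distrib)
      finally show ?thesis using quad_nonneg_at[OF pos' q] by simp
    qed
    then have "psd n S'" unfolding psd_def using sym by (auto simp: S'_def mult.commute)
    then obtain w where w: "\<forall>i<n. \<forall>j<n. S' i j = (\<Sum>r<n. w r i * w r j)"
      using Suc.IH by blast
    define w' where "w' r i = (if r = n then S i n / sqrt (S n n) else if i = n then 0 else w r i)" for r i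
    have "S i j = (\<Sum>r<Suc n. w' r i * w' r j)" if "i < Suc n" "j < Suc n" for i j
    proof -
      have last: "w' n i * w' n j = S i n * S j n / S n n"
        using q by (simp add: w'_def)
      show ?thesis
      proof (cases "i = n \<or> j = n")
        case True
        then have "(\<Sum>r<n. w' r i * w' r j) = 0" by (intro sum.neutral) (auto simp: w'_def)
        moreover have "S i n * S j n / S n n = S i j"
          using True q sym that by auto
        ultimately show ?thesis using last by simp
      next
        case False
        then have "i < n" "j < n" using that by auto
        then have "(\<Sum>r<n. w' r i * w' r j) = S' i j" using w by (simp add: w'_def)
        then show ?thesis using last by (simp add: S'_def)
      qed
    qed
    then show ?thesis by blast
  qed
qed

text \<open>Writing \<open>S\<close> as a sum of matrices \<open>w w^T\<close> turns the inner
  product into a sum of values of the quadratic form of \<open>Y\<close>.\<close>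

lemma psd_frob_inner_nonneg:
  assumes "psd n S" "psd n Y"
  shows "frob_inner n S Y \<ge> 0"
proof -
  obtain w where w: "\<forall>i<n. \<forall>j<n. S i j = (\<Sum>r<n. w r i * w r j)"
    using psd_cholesky[OF assms(1)] by blast
  have "frob_inner n S Y = (\<Sum>i<n. \<Sum>j<n. \<Sum>r<n. w r i * Y i j * w r j)"
    unfolding frob_inner_def using w by (intro sum.cong refl) (simp add: sum_distrib_left mult_ac)
  also have "\<dots> = (\<Sum>i<n. \<Sum>r<n. \<Sum>j<n. w r i * Y i j * w r j)"
    by (rule sum.cong[OF refl], rule sum.swap)
  also have "\<dots> = (\<Sum>r<n. \<Sum>i<n. \<Sum>j<n. w r i * Y i j * w r j)"
    by (rule sum.swap)
  also have "\<dots> \<ge> 0"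
    by (rule sum_nonneg) (use assms(2) in \<open>simp add: psd_def\<close>)
  finally show ?thesis .
qed

section \<open>Feasibility of Gram matrices and complementary slackness\<close>

lemma gram_feasible:
  assumes "unit_columns n k V"
  shows "sdp_feasible n (gram k V)"
proof -
  have "(\<Sum>i<n. \<Sum>j<n. x i * gram k V i j * x j) = (\<Sum>a<k. (\<Sum>i<n. x i * V a i)\<^sup>2)" for x
  proof -
    have "(\<Sum>i<n. \<Sum>j<n. x i * gram k V i j * x j) = (\<Sum>i<n. \<Sum>j<n. \<Sum>a<k. (x i * V a i) * (x j * V a j))"
      unfolding gram_def by (simp add: sum_distrib_left sum_distrib_right mult_ac)
    also have "\<dots> = (\<Sum>i<n. \<Sum>a<k. \<Sum>j<n. (x i * V a i) * (x j * V a j))"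
      by (rule sum.cong[OF refl], rule sum.swap)
    also have "\<dots> = (\<Sum>a<k. (\<Sum>i<n. x i * V a i)\<^sup>2)"
      unfolding power2_eq_square sum_product by (rule sum.swap)
    finally show ?thesis .
  qed
  then have "psd n (gram k V)"
    unfolding psd_def by (auto simp: gram_def mult.commute intro!: sum_nonneg)
  moreover have "gram k V i i = 1" if "i < n" for i
    using assms that unfolding unit_columns_def gram_def by (simp add: power2_eq_square)
  ultimately show ?thesis by (simp add: sdp_feasible_def)
qed

text \<open>The dual slack matrix \<open>C + diag(y)\<close> of the SDP, at the multipliers
  \<open>y\<close> that the critical point prescribes.\<close>

definition dual_slack :: "nat \<Rightarrow> nat \<Rightarrow> (nat \<Rightarrow> nat \<Rightarrow> real) \<Rightarrow> (nat \<Rightarrow> nat \<Rightarrow> real) \<Rightarrow> nat \<Rightarrow> nat \<Rightarrow> real" where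
  "dual_slack n k C V i j = C i j + (if i = j then gnorm n k C V i else 0)"

lemma dual_slack_annihilates:
  assumes "first_order_critical n k C V" "i < n" "a < k"
  shows "(\<Sum>j<n. dual_slack n k C V i j * V a j) = 0"
proof -
  have "(\<Sum>j<n. dual_slack n k C V i j * V a j) = gvec n C V i a + gnorm n k C V i * V a i"
    using assms(2) by (simp add: dual_slack_def gvec_def distrib_right sum.distrib if_distrib[of "\<lambda>x. x * _"] cong: if_cong)
  then show ?thesis using assms by (simp add: first_order_critical_def)
qed

lemma frob_inner_dual_slack:
  assumes "\<forall>i<n. X i i = 1"
  shows "frob_inner n (dual_slack n k C V) X = frob_inner n C X + (\<Sum>i<n. gnorm n k C V i)"
proof -
  have "(\<Sum>j<n. dual_slack n k C V i j * X i j) = (\<Sum>j<n. C i j * X i j) + gnorm n k C V i" if "i < n" for i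
    using that assms by (simp add: dual_slack_def distrib_right sum.distrib if_distrib[of "\<lambda>x. x * _"] cong: if_cong)
  then show ?thesis by (simp add: frob_inner_def sum.distrib)
qed

text \<open>Complementary slackness: the slack matrix annihilates the rows of \<open>V\<close>, so
  its inner product with the Gram matrix is 0, while with any feasible \<open>Y\<close> it is
  nonnegative. On matrices with unit diagonal this inner product differs from the cost only by the
  constant sum of the multipliers.\<close>

lemma critical_psd_slack_optimal:
  assumes crit: "first_order_critical n k C V" and psd: "psd n (dual_slack n k C V)"
  shows "sdp_optimal n C (gram k V)"
proof -
  have feas: "sdp_feasible n (gram k V)"
    using crit gram_feasible by (simp add: first_order_critical_def)
  have "frob_inner n (dual_slack n k C V) (gram k V) = (\<Sum>i<n. \<Sum>a<k. V a i * (\<Sum>j<n. dual_slack n k C V i j * V a j))"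
    unfolding frob_inner_def gram_def sum_distrib_left
    by (rule sum.cong[OF refl], subst sum.swap) (simp add: mult_ac)
  also have "\<dots> = 0" using dual_slack_annihilates[OF crit] by simp
  finally have 0: "frob_inner n (dual_slack n k C V) (gram k V) = 0" .
  have "frob_inner n C (gram k V) \<le> frob_inner n C Y" if Y: "sdp_feasible n Y" for Y
    using psd_frob_inner_nonneg[OF psd, of Y] 0 frob_inner_dual_slack[of n _ k C V] feas Y
    unfolding sdp_feasible_def by fastforce
  then show ?thesis using feas by (simp add: sdp_optimal_def)
qed

section \<open>Generic rank deficiency\<close>

text \<open>Gaussian elimination, by induction on the number of rows. Either the rows of
  \<open>V\<close> are dependent, or there are \<open>k\<close> pivot columns \<open>I\<close>, and
  \<open>\<alpha>\<close> is the inverse of the \<open>k x k\<close> block of \<open>V\<close> on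
  them.\<close>

lemma row_dependence_or_pivots:
  fixes V :: "nat \<Rightarrow> nat \<Rightarrow> real"
  shows "(\<exists>u. (\<exists>a<k. u a \<noteq> 0) \<and> (\<forall>j<n. (\<Sum>a<k. u a * V a j) = 0)) \<or>
    (\<exists>I \<alpha>. I \<subseteq> {..<n} \<and> card I = k \<and>
       (\<forall>i\<in>I. \<forall>j\<in>I. (\<Sum>a<k. \<alpha> i a * V a j) = (if i = j then 1 else 0)))"
proof (induction k)
  case 0
  show ?case by (intro disjI2 exI[of _ "{}"]) auto
next
  case (Suc k)
  show ?case
  proof (cases "\<exists>u. (\<exists>a<k. u a \<noteq> 0) \<and> (\<forall>j<n. (\<Sum>a<k. u a * V a j) = 0)")
    case True
    then obtain u a where "a < k" "u a \<noteq> 0" "\<forall>j<n. (\<Sum>a<k. u a * V a j) = 0" by blast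
    then show ?thesis
      by (intro disjI1 exI[of _ "u(k := 0)"]) (auto intro!: exI[of _ a])
  next
    case False
    then obtain I \<alpha> where I: "I \<subseteq> {..<n}" "card I = k"
      and \<alpha>: "\<And>i j. i \<in> I \<Longrightarrow> j \<in> I \<Longrightarrow> (\<Sum>a<k. \<alpha> i a * V a j) = (if i = j then 1 else 0)"
      using Suc by blast
    have finI: "finite I" using I(1) finite_subset by blast
    define lc where "lc u j = (\<Sum>a<Suc k. u a * V a j)" for u j
    define \<alpha>' where "\<alpha>' i = (\<alpha> i)(k := 0)" for i
    have \<alpha>': "lc (\<alpha>' i) j = (if i = j then 1 else 0)" if "i \<in> I" "j \<in> I" for i j
      using \<alpha>[OF that] by (simp add: lc_def \<alpha>'_def)
    \<comment> \<open>The combination of rows given by row \<open>k\<close> minus the combination of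
      earlier rows that agrees with it on \<open>I\<close>. It vanishes on all old pivot columns,
      and its coefficient at \<open>k\<close> is 1.\<close>
    define u where "u a = (if a = k then 1 else 0) - (\<Sum>i\<in>I. V k i * \<alpha>' i a)" for a
    have lcu: "lc u j = V k j - (\<Sum>i\<in>I. V k i * lc (\<alpha>' i) j)" for j
    proof -
      have "lc u j = (\<Sum>a<Suc k. (if a = k then 1 else 0) * V a j) - (\<Sum>a<Suc k. \<Sum>i\<in>I. V k i * (\<alpha>' i a * V a j))"
        unfolding lc_def u_def by (simp only: left_diff_distrib sum_subtractf sum_distrib_right mult.assoc)
      also have "(\<Sum>a<Suc k. (if a = k then 1 else 0) * V a j) = V k j"
        by simp
      also have "(\<Sum>a<Suc k. \<Sum>i\<in>I. V k i * (\<alpha>' i a * V a j)) = (\<Sum>i\<in>I. V k i * lc (\<alpha>' i) j)"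
        unfolding lc_def sum_distrib_left by (rule sum.swap)
      finally show ?thesis .
    qed
    have uI: "lc u j = 0" if "j \<in> I" for j
      using that finI by (simp add: lcu \<alpha>' if_distrib cong: if_cong sum.cong)
    have "u k = 1" by (simp add: u_def \<alpha>'_def)
    show ?thesis
    proof (cases "\<forall>j<n. lc u j = 0")
      case True
      then show ?thesis
        using \<open>u k = 1\<close> unfolding lc_def by (intro disjI1 exI[of _ u]) (auto intro!: exI[of _ k])
    next
      case False
      then obtain j0 where j0: "j0 < n" "lc u j0 \<noteq> 0" by blast
      then have "j0 \<notin> I" using uI by blast
      define z where "z a = u a / lc u j0" for a
      have lcz: "lc z j = lc u j / lc u j0" for j
        unfolding lc_def z_def by (simp add: sum_divide_distrib add_divide_distrib)
      \<comment> \<open>The scaled combination \<open>z\<close> is the new pivot row. Subtracting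
        multiples of it clears column \<open>j0\<close> from the old rows and leaves the old pivot
        columns unchanged, since \<open>z\<close> is 0 there.\<close>
      define \<beta> where "\<beta> i = (if i = j0 then z else (\<lambda>a. \<alpha>' i a - lc (\<alpha>' i) j0 * z a))" for i
      have lcd: "lc (\<lambda>a. f a - c * g a) j = lc f j - c * lc g j" for f g c j
        unfolding lc_def by (simp add: left_diff_distrib sum_subtractf sum_distrib_left algebra_simps)
      have "lc (\<beta> i) j = (if i = j then 1 else 0)" if "i \<in> insert j0 I" "j \<in> insert j0 I" for i j
        using that \<open>j0 \<notin> I\<close> j0(2) uI \<alpha>' by (auto simp: \<beta>_def lcd lcz)
      moreover have "card (insert j0 I) = Suc k" "insert j0 I \<subseteq> {..<n}"
        using I finI \<open>j0 \<notin> I\<close> j0 by auto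
      ultimately show ?thesis
        unfolding lc_def by (intro disjI2 exI[of _ "insert j0 I"] exI[of _ \<beta>]) blast
    qed
  qed
qed

section \<open>Counting index pairs\<close>

lemma card_strict_pairs:
  fixes J :: "'a::linorder set"
  assumes "finite J"
  shows "2 * card {(i, j). i \<in> J \<and> j \<in> J \<and> i < j} + card J = card J * card J"
proof -
  let ?A = "{(i, j). i \<in> J \<and> j \<in> J \<and> i < j}" and ?B = "{(i, j). i \<in> J \<and> j \<in> J \<and> j < i}"
  have fin: "finite ?A" "finite ?B"
    using assms by (auto intro: finite_subset[of _ "J \<times> J"])
  have "?B = prod.swap ` ?A" by force
  then have "card ?B = card ?A" by (simp add: card_image)
  moreover have "J \<times> J = (?A \<union> ?B) \<union> (\<lambda>i. (i, i)) ` J" by force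
  then have "card J * card J = card ((?A \<union> ?B) \<union> (\<lambda>i. (i, i)) ` J)"
    by (metis card_cartesian_product)
  moreover have "card ((?A \<union> ?B) \<union> (\<lambda>i. (i, i)) ` J) = card (?A \<union> ?B) + card ((\<lambda>i. (i, i)) ` J)"
    using fin assms by (intro card_Un_disjoint) auto
  moreover have "card (?A \<union> ?B) = card ?A + card ?B"
    using fin by (intro card_Un_disjoint) auto
  moreover have "card ((\<lambda>i. (i, i)) ` J) = card J" by (simp add: card_image inj_on_def)
  ultimately show ?thesis by linarith
qed

lemma card_weak_pairs:
  fixes J :: "'a::linorder set"
  assumes "finite J"
  shows "2 * card {(i, j). i \<in> J \<and> j \<in> J \<and> i \<le> j} = card J * card J + card J"
proof -
  let ?A = "{(i, j). i \<in> J \<and> j \<in> J \<and> i < j}"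
  have fin: "finite ?A"
    using assms by (auto intro: finite_subset[of _ "J \<times> J"])
  have eq: "{(i, j). i \<in> J \<and> j \<in> J \<and> i \<le> j} = ?A \<union> (\<lambda>i. (i, i)) ` J" by force
  have "card (?A \<union> (\<lambda>i. (i, i)) ` J) = card ?A + card ((\<lambda>i. (i, i)) ` J)"
    using fin assms by (intro card_Un_disjoint) auto
  moreover have "card ((\<lambda>i. (i, i)) ` J) = card J" by (simp add: card_image inj_on_def)
  ultimately show ?thesis using card_strict_pairs[OF assms] unfolding eq by linarith
qed

lemma card_upper_idx: "2 * card (upper_idx n) + n = n * n"
proof -
  have "upper_idx n = {(i, j). i \<in> {..<n} \<and> j \<in> {..<n} \<and> i < j}"
    by (auto simp: upper_idx_def)
  then show ?thesis using card_strict_pairs[of "{..<n}"] by simp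
qed

lemma finite_upper_idx: "finite (upper_idx n)"
  by (rule finite_subset[of _ "{..<n} \<times> {..<n}"]) (auto simp: upper_idx_def)

text \<open>Every column of \<open>M\<close> is a combination of the columns in \<open>J\<close>, with coefficients \<open>\<beta>\<close> read off
  the kernel vectors; applied to rows as well, this gives \<open>M = \<beta>\<^sup>T M\<^sub>J\<^sub>J \<beta>\<close>.\<close>
lemma kernel_block_factorization:
  fixes M :: "nat \<Rightarrow> nat \<Rightarrow> real"
  assumes sym: "\<And>i j. M i j = M j i"
    and I: "I \<subseteq> {..<n}"
    and ker: "\<And>a i. a < n \<Longrightarrow> i \<in> I \<Longrightarrow> (\<Sum>j<n. M a j * w i j) = 0"
    and w: "\<And>i j. i \<in> I \<Longrightarrow> j \<in> I \<Longrightarrow> w i j = (if i = j then 1 else 0)"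
    and ab: "a < n" "b < n"
  defines "J \<equiv> {..<n} - I"
  defines "\<beta> \<equiv> \<lambda>l c. if c \<in> J then (if l = c then 1 else 0) else - w c l"
  shows "M a b = (\<Sum>l\<in>J. \<Sum>l'\<in>J. \<beta> l a * M l l' * \<beta> l' b)"
proof -
  have fin: "finite I" "finite J" using I finite_subset unfolding J_def by auto
  have col: "M a c = (\<Sum>l\<in>J. M a l * \<beta> l c)" if "a < n" "c < n" for a c
  proof (cases "c \<in> J")
    case True
    then have "(\<Sum>l\<in>J. M a l * \<beta> l c) = (\<Sum>l\<in>J. if l = c then M a l else 0)"
      by (intro sum.cong) (auto simp: \<beta>_def)
    then show ?thesis using True fin by simp
  next
    case False
    then have c: "c \<in> I" using that by (simp add: J_def)
    have "{..<n} = I \<union> J" "I \<inter> J = {}" using I by (auto simp: J_def)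
    then have "0 = (\<Sum>j\<in>I. M a j * w c j) + (\<Sum>j\<in>J. M a j * w c j)"
      using ker[OF \<open>a < n\<close> c] fin by (simp add: sum.union_disjoint)
    also have "(\<Sum>j\<in>I. M a j * w c j) = M a c"
      using c fin by (simp add: w if_distrib cong: if_cong sum.cong)
    finally show ?thesis
      using False by (simp add: \<beta>_def sum_negf)
  qed
  have Jn: "l < n" if "l \<in> J" for l using that by (simp add: J_def)
  have "M a b = (\<Sum>l'\<in>J. M a l' * \<beta> l' b)" by (rule col[OF ab])
  also have "\<dots> = (\<Sum>l'\<in>J. (\<Sum>l\<in>J. M l' l * \<beta> l a) * \<beta> l' b)"
    using sym[of a] col[OF Jn ab(1)] by (intro sum.cong) auto
  also have "\<dots> = (\<Sum>l'\<in>J. \<Sum>l\<in>J. \<beta> l a * M l l' * \<beta> l' b)"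
    unfolding sum_distrib_right using sym by (intro sum.cong refl) (simp add: mult_ac)
  also have "\<dots> = (\<Sum>l\<in>J. \<Sum>l'\<in>J. \<beta> l a * M l l' * \<beta> l' b)" by (rule sum.swap)
  finally show ?thesis .
qed

section \<open>The null set of costs that admit a large kernel\<close>

lemma sym_cost_sym: "sym_cost A i j = sym_cost A j i"
  by (simp add: sym_cost_def min.commute max.commute)

text \<open>The block factorization recovers the off-diagonal entries of \<open>M\<close>, hence
  \<open>A\<close>, as polynomials in the upper triangle of \<open>M\<close> on the complement
  \<open>J\<close> of \<open>I\<close> and in the kernel coefficients indexed by
  \<open>J x I\<close>. With \<open>r = n - k\<close> these are \<open>r(r+1)/2 + rk\<close>
  parameters, fewer than \<open>n(n-1)/2\<close> exactly when \<open>2n < k(k+1)\<close>. The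
  diagonal of \<open>M\<close> is left free because it will hold the unknown multipliers.\<close>

lemma generic_corank:
  fixes n k :: nat
  assumes k: "2 * n < k * k + k" and I: "I \<subseteq> {..<n}" "card I = k"
  shows "AE A in PiM (upper_idx n) (\<lambda>_. lborel).
    \<not> (\<exists>M w. (\<forall>i j. M i j = M j i) \<and> (\<forall>i<n. \<forall>j<n. i \<noteq> j \<longrightarrow> M i j = sym_cost A i j) \<and>
         (\<forall>a<n. \<forall>i\<in>I. (\<Sum>j<n. M a j * w i j) = 0) \<and>
         (\<forall>i\<in>I. \<forall>j\<in>I. w i j = (if i = j then 1 else 0)))"
proof -
  define J where "J = {..<n} - I"
  have fin: "finite I" "finite J" using I finite_subset unfolding J_def by auto
  have "card J = n - k" using I fin by (simp add: J_def card_Diff_subset)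
  moreover have "k \<le> n" using I card_mono[of "{..<n}" I] by simp
  ultimately obtain r where r: "n = k + r" "card J = r" by (metis le_add_diff_inverse)
  define P where "P = {(i, j). i \<in> J \<and> j \<in> J \<and> i \<le> j} \<union> J \<times> I"
  have finP: "finite P"
    unfolding P_def using fin by (auto intro: finite_subset[of _ "J \<times> J"])
  have "card P = card {(i, j). i \<in> J \<and> j \<in> J \<and> i \<le> j} + card (J \<times> I)"
    unfolding P_def using fin
    by (intro card_Un_disjoint) (auto intro: finite_subset[of _ "J \<times> J"] simp: J_def)
  then have "2 * card P = r * r + r + 2 * (r * k)"
    using card_weak_pairs[OF fin(2)] r I by (simp add: card_cartesian_product)
  moreover have "2 * card (upper_idx n) + (k + r) = k * k + 2 * (r * k) + r * r"
    using card_upper_idx[of n] r by (simp add: algebra_simps)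
  ultimately have card: "card P < card (upper_idx n)"
    using k r by linarith
  define \<beta> where "\<beta> s l c = (if c \<in> J then (if l = c then 1 else 0) else - s (l, c))"
    for s :: "nat \<times> nat \<Rightarrow> real" and l c
  define F where "F s \<kappa> = (\<Sum>l\<in>J. \<Sum>l'\<in>J. \<beta> s l (fst \<kappa>) * s (min l l', max l l') * \<beta> s l' (snd \<kappa>))"
    for s and \<kappa> :: "nat \<times> nat"
  have \<beta>lip: "locally_lipschitz P (\<lambda>s. \<beta> s l c)" if "l \<in> J" "c < n" for l c
  proof (cases "c \<in> J")
    case True
    then show ?thesis by (simp add: \<beta>_def locally_lipschitz_const)
  next
    case False
    then have "(l, c) \<in> P" using that by (auto simp: P_def J_def)
    then show ?thesis
      using False by (simp add: \<beta>_def locally_lipschitz_coord locally_lipschitz_uminus)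
  qed
  have "locally_lipschitz P (\<lambda>s. F s \<kappa>)" if "\<kappa> \<in> upper_idx n" for \<kappa>
  proof -
    have "fst \<kappa> < n" "snd \<kappa> < n" using that by (auto simp: upper_idx_def)
    moreover have "(min l l', max l l') \<in> P" if "l \<in> J" "l' \<in> J" for l l'
      using that by (auto simp: P_def min_def max_def)
    ultimately show ?thesis
      unfolding F_def
      by (intro locally_lipschitz_sum locally_lipschitz_mult \<beta>lip locally_lipschitz_coord) auto
  qed
  then have "AE A in PiM (upper_idx n) (\<lambda>_. lborel). \<not> (\<exists>s. \<forall>\<kappa>\<in>upper_idx n. A \<kappa> = F s \<kappa>)"
    by (rule lowdim_image_null[OF finP finite_upper_idx card])
  then show ?thesis
  proof (eventually_elim, intro notI, elim exE conjE)
    fix A :: "nat \<times> nat \<Rightarrow> real" and M w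
    assume no: "\<not> (\<exists>s. \<forall>\<kappa>\<in>upper_idx n. A \<kappa> = F s \<kappa>)"
      and sym: "\<forall>i j. M i j = M j i" and off: "\<forall>i<n. \<forall>j<n. i \<noteq> j \<longrightarrow> M i j = sym_cost A i j"
      and ker: "\<forall>a<n. \<forall>i\<in>I. (\<Sum>j<n. M a j * w i j) = 0"
      and w: "\<forall>i\<in>I. \<forall>j\<in>I. w i j = (if i = j then 1 else 0)"
    \<comment> \<open>A second index in \<open>J\<close> marks an entry of \<open>M\<close>; one in
      \<open>I\<close> marks a coefficient of the kernel vector \<open>w j\<close>, so the two
      indices are swapped there.\<close>
    define s where "s = (\<lambda>(i, j). if j \<in> J then M i j else w j i)"
    have \<beta>s: "\<beta> s l c = (if c \<in> {..<n} - I then (if l = c then 1 else 0) else - w c l)" for l c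
      by (simp add: \<beta>_def s_def J_def)
    have sM: "s (min l l', max l l') = M l l'" if "l \<in> J" "l' \<in> J" for l l'
      using that sym by (cases "l \<le> l'") (auto simp: s_def min_def max_def)
    have "A \<kappa> = F s \<kappa>" if "\<kappa> \<in> upper_idx n" for \<kappa>
    proof -
      obtain a b where \<kappa>: "\<kappa> = (a, b)" by (cases \<kappa>)
      have ab: "a < n" "b < n" "a < b" using that by (auto simp: upper_idx_def \<kappa>)
      have "A \<kappa> = M a b" using off ab by (simp add: sym_cost_def \<kappa> min_def max_def)
      also have "\<dots> = (\<Sum>l\<in>J. \<Sum>l'\<in>J. \<beta> s l a * M l l' * \<beta> s l' b)"
        unfolding \<beta>s J_def
        by (rule kernel_block_factorization) (use sym I(1) ker w ab in blast)+
      also have "\<dots> = F s \<kappa>"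
        unfolding F_def \<kappa> fst_conv snd_conv by (intro sum.cong refl) (simp add: sM)
      finally show ?thesis .
    qed
    then show False using no by blast
  qed
qed

text \<open>Full row rank would give pivots \<open>I\<close>, and the combinations of rows of
  \<open>V\<close> through \<open>\<alpha>\<close> would be kernel vectors of the slack matrix with
  an identity block on \<open>I\<close>. For each \<open>I\<close> this is excluded outside a null
  set that does not depend on \<open>V\<close>. There are finitely many \<open>I\<close>, so one
  null set serves all \<open>V\<close>.\<close>

lemma generic_rank_deficient:
  fixes n k :: nat
  assumes k: "2 * n < k * k + k"
  shows "AE A in PiM (upper_idx n) (\<lambda>_. lborel).
    \<forall>V. first_order_critical n k (sym_cost A) V \<longrightarrow>
      (\<exists>u. (\<exists>a<k. u a \<noteq> 0) \<and> (\<forall>j<n. (\<Sum>a<k. u a * V a j) = 0))"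
proof -
  define Bad where "Bad A I \<longleftrightarrow> (\<exists>M w. (\<forall>i j. M i j = M j i) \<and> (\<forall>i<n. \<forall>j<n. i \<noteq> j \<longrightarrow> M i j = sym_cost A i j) \<and>
         (\<forall>a<n. \<forall>i\<in>I. (\<Sum>j<n. M a j * w i j) = 0) \<and>
         (\<forall>i\<in>I. \<forall>j\<in>I. w i j = (if i = j then 1 else (0::real))))" for A I
  have "AE A in PiM (upper_idx n) (\<lambda>_. lborel). \<forall>I\<in>{I. I \<subseteq> {..<n} \<and> card I = k}. \<not> Bad A I"
    using generic_corank[OF k] unfolding Bad_def by (intro AE_finite_allI) auto
  then show ?thesis
  proof (eventually_elim, intro allI impI)
    fix A V
    assume good: "\<forall>I\<in>{I. I \<subseteq> {..<n} \<and> card I = k}. \<not> Bad A I"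
      and crit: "first_order_critical n k (sym_cost A) V"
    define M where "M = dual_slack n k (sym_cost A) V"
    have MV: "(\<Sum>j<n. M i j * V a j) = 0" if "i < n" "a < k" for i a
      unfolding M_def by (rule dual_slack_annihilates[OF crit that])
    show "\<exists>u. (\<exists>a<k. u a \<noteq> 0) \<and> (\<forall>j<n. (\<Sum>a<k. u a * V a j) = 0)"
    proof (rule ccontr)
      assume "\<not> ?thesis"
      then obtain I \<alpha> where I: "I \<subseteq> {..<n}" "card I = k"
        and \<alpha>: "\<forall>i\<in>I. \<forall>j\<in>I. (\<Sum>a<k. \<alpha> i a * V a j) = (if i = j then 1 else 0)"
        using row_dependence_or_pivots[where n = n and k = k and V = V] by blast
      have "(\<Sum>j<n. M i j * (\<Sum>a<k. \<alpha> l a * V a j)) = 0" if "i < n" for i l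
      proof -
        have "(\<Sum>j<n. M i j * (\<Sum>a<k. \<alpha> l a * V a j)) = (\<Sum>a<k. \<alpha> l a * (\<Sum>j<n. M i j * V a j))"
          unfolding sum_distrib_left by (subst sum.swap) (simp add: mult_ac)
        then show ?thesis using MV[OF that] by simp
      qed
      moreover have "\<forall>i j. M i j = M j i" by (simp add: M_def dual_slack_def sym_cost_sym)
      moreover have "\<forall>i<n. \<forall>j<n. i \<noteq> j \<longrightarrow> M i j = sym_cost A i j" by (simp add: M_def dual_slack_def)
      ultimately have "Bad A I"
        unfolding Bad_def using \<alpha>
        by (intro exI[of _ M] exI[of _ "\<lambda>i j. \<Sum>a<k. \<alpha> i a * V a j"]) blast
      then show False using good I by blast
    qed
  qed
qed

section \<open>Gauss--Seidel sweeps\<close>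

text \<open>For \<open>C\<close> with zero diagonal, this solves row \<open>i\<close> of
  \<open>(C + diag(y)) x = 0\<close> for the coordinate \<open>i\<close>.\<close>

definition gs_step :: "nat \<Rightarrow> (nat \<Rightarrow> nat \<Rightarrow> real) \<Rightarrow> (nat \<Rightarrow> real) \<Rightarrow> nat \<Rightarrow> (nat \<Rightarrow> real) \<Rightarrow> (nat \<Rightarrow> real)" where
  "gs_step n C y i x = x(i := - (\<Sum>j<n. C i j * x j) / y i)"

definition gs_partial :: "nat \<Rightarrow> (nat \<Rightarrow> nat \<Rightarrow> real) \<Rightarrow> (nat \<Rightarrow> real) \<Rightarrow> nat \<Rightarrow> (nat \<Rightarrow> real) \<Rightarrow> (nat \<Rightarrow> real)" where
  "gs_partial n C y m x = fold (gs_step n C y) [0..<m] x"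

definition qform :: "nat \<Rightarrow> (nat \<Rightarrow> nat \<Rightarrow> real) \<Rightarrow> (nat \<Rightarrow> real) \<Rightarrow> real" where
  "qform n S x = (\<Sum>i<n. \<Sum>j<n. x i * S i j * x j)"

lemma gs_partial_0: "gs_partial n C y 0 x = x"
  by (simp add: gs_partial_def)

lemma gs_partial_Suc: "gs_partial n C y (Suc m) x = gs_step n C y m (gs_partial n C y m x)"
  by (simp add: gs_partial_def)

lemma gs_partial_ge: "m \<le> j \<Longrightarrow> gs_partial n C y m x j = x j"
  by (induction m) (auto simp: gs_partial_0 gs_partial_Suc gs_step_def)

lemma gs_partial_stable:
  assumes "m \<le> m'" "j < m"
  shows "gs_partial n C y m' x j = gs_partial n C y m x j"
  using assms(1)
proof (induction m' rule: dec_induct)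
  case (step m')
  then show ?case using assms(2) by (simp add: gs_partial_Suc gs_step_def)
qed simp

lemma qform_update:
  assumes sym: "\<And>i j. S i j = S j i" and i: "i < n"
  shows "qform n S (x(i := x i + d)) = qform n S x + 2 * d * (\<Sum>j<n. S i j * x j) + d\<^sup>2 * S i i"
proof -
  define e where "e j = (if j = i then d else 0 :: real)" for j
  have upd: "(x(i := x i + d)) j = x j + e j" for j by (simp add: e_def)
  have es: "(\<Sum>j<n. e j * f j) = d * f i" for f
    using i by (simp add: e_def if_distrib[of "\<lambda>z. z * _"] cong: if_cong)
  define q where "q = qform n S (x(i := x i + d))"
  have "q
      = (\<Sum>a<n. \<Sum>b<n. x a * S a b * x b + e a * (S a b * x b) + e b * (S a b * x a) + e a * (e b * S a b))"
    unfolding q_def qform_def upd by (intro sum.cong refl) (simp add: algebra_simps)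
  also have "\<dots> = qform n S x + (\<Sum>a<n. e a * (\<Sum>b<n. S a b * x b)) + (\<Sum>a<n. \<Sum>b<n. e b * (S a b * x a))
      + (\<Sum>a<n. e a * (\<Sum>b<n. e b * S a b))"
    unfolding qform_def by (simp only: sum.distrib sum_distrib_left)
  also have "\<dots> = qform n S x + d * (\<Sum>j<n. S i j * x j) + d * (\<Sum>a<n. S a i * x a) + d * (d * S i i)"
    unfolding es by (simp add: sum_distrib_left)
  also have "(\<Sum>a<n. S a i * x a) = (\<Sum>j<n. S i j * x j)"
    by (intro sum.cong refl arg_cong2[where f = "(*)"] sym)
  finally show ?thesis
    unfolding q_def[symmetric] by (simp add: power2_eq_square algebra_simps)
qed

text \<open>A bounded section of \<open>x \<mapsto> A x\<close> over its range. It stands in for the spectral gap in the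
  estimate \<open>\<bar>x\<^sup>T S x\<bar> \<le> c \<parallel>S x\<parallel>\<^sup>2\<close>, so that no diagonalization of \<open>S\<close> is needed.\<close>
lemma bounded_preimage:
  fixes A :: "nat \<Rightarrow> nat \<Rightarrow> real"
  shows "\<exists>c\<ge>0. \<forall>x. \<exists>x'. (\<forall>i<m. (\<Sum>j<n. A i j * x' j) = (\<Sum>j<n. A i j * x j)) \<and>
           (\<forall>j<n. \<bar>x' j\<bar> \<le> c * (\<Sum>i<m. \<bar>\<Sum>j<n. A i j * x j\<bar>))"
proof (induction m)
  case 0
  show ?case by (auto intro!: exI[of _ 0] exI[of _ "\<lambda>_. 0"])
next
  case (Suc m)
  define ap where "ap i x = (\<Sum>j<n. A i j * x j)" for i x
  have ap_add: "ap i (\<lambda>j. x j + s * z j) = ap i x + s * ap i z" for i x z s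
    by (simp add: ap_def distrib_left sum.distrib sum_distrib_left mult_ac)
  obtain c where c: "c \<ge> 0"
    and ex: "\<And>x. \<exists>x'. (\<forall>i<m. ap i x' = ap i x) \<and> (\<forall>j<n. \<bar>x' j\<bar> \<le> c * (\<Sum>i<m. \<bar>ap i x\<bar>))"
    using Suc unfolding ap_def by blast
  show ?case
  \<comment> \<open>If no such \<open>z\<close> exists, row \<open>m\<close> is determined by the
    earlier rows and the old preimage already works. Otherwise a multiple of \<open>z\<close>
    corrects the value of row \<open>m\<close> and leaves the earlier ones unchanged.\<close>
  proof (cases "\<exists>z. (\<forall>i<m. ap i z = 0) \<and> ap m z \<noteq> 0")
    case False
    have "\<exists>x'. (\<forall>i<Suc m. ap i x' = ap i x) \<and> (\<forall>j<n. \<bar>x' j\<bar> \<le> c * (\<Sum>i<Suc m. \<bar>ap i x\<bar>))" for x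
    proof -
      obtain x' where x': "\<forall>i<m. ap i x' = ap i x" "\<forall>j<n. \<bar>x' j\<bar> \<le> c * (\<Sum>i<m. \<bar>ap i x\<bar>)"
        using ex[of x] by blast
      have "\<forall>i<m. ap i (\<lambda>j. x' j + (-1) * x j) = 0" using x'(1) unfolding ap_add by simp
      then have "ap m (\<lambda>j. x' j + (-1) * x j) = 0" using False by blast
      then have "ap m x' = ap m x" unfolding ap_add by simp
      moreover have "c * (\<Sum>i<m. \<bar>ap i x\<bar>) \<le> c * (\<Sum>i<Suc m. \<bar>ap i x\<bar>)"
        using c by (intro mult_left_mono) auto
      ultimately show ?thesis using x' less_Suc_eq by (intro exI[of _ x']) force
    qed
    then show ?thesis using c unfolding ap_def by blast
  next
    case True
    then obtain z where z: "\<forall>i<m. ap i z = 0" "ap m z \<noteq> 0" by blast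
    define Z where "Z = (\<Sum>j<n. \<bar>z j\<bar>)"
    define E where "E = (\<Sum>j<n. \<bar>A m j\<bar>)"
    \<comment> \<open>\<open>E * c\<close> bounds the value of row \<open>m\<close> at the old
      preimage, relative to the total \<open>T\<close>; dividing by \<open>ap m z\<close> bounds the
      multiple \<open>s\<close> of \<open>z\<close> that is added.\<close>
    define c' where "c' = c + (1 + E * c) / \<bar>ap m z\<bar> * Z"
    have nn: "Z \<ge> 0" "E \<ge> 0" by (auto simp: Z_def E_def sum_nonneg)
    have "c' \<ge> 0" unfolding c'_def using c nn by auto
    moreover have "\<exists>x'. (\<forall>i<Suc m. ap i x' = ap i x) \<and> (\<forall>j<n. \<bar>x' j\<bar> \<le> c' * (\<Sum>i<Suc m. \<bar>ap i x\<bar>))" for x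
    proof -
      obtain x' where x': "\<forall>i<m. ap i x' = ap i x" "\<forall>j<n. \<bar>x' j\<bar> \<le> c * (\<Sum>i<m. \<bar>ap i x\<bar>)"
        using ex[of x] by blast
      define s where "s = (ap m x - ap m x') / ap m z"
      define T where "T = (\<Sum>i<Suc m. \<bar>ap i x\<bar>)"
      have T0: "T \<ge> 0" by (simp add: T_def sum_nonneg)
      have T: "\<bar>ap m x\<bar> \<le> T" "(\<Sum>i<m. \<bar>ap i x\<bar>) \<le> T" by (auto simp: T_def sum_nonneg)
      have x'T: "\<bar>x' j\<bar> \<le> c * T" if "j < n" for j
        using x'(2) that mult_left_mono[OF T(2) c] by force
      have "\<bar>ap m x'\<bar> \<le> (\<Sum>j<n. \<bar>A m j\<bar> * \<bar>x' j\<bar>)"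
        unfolding ap_def by (rule order_trans[OF sum_abs]) (simp add: abs_mult)
      also have "\<dots> \<le> (\<Sum>j<n. \<bar>A m j\<bar> * (c * T))"
        using x'T by (intro sum_mono mult_left_mono) auto
      also have "\<dots> = E * (c * T)" by (simp add: E_def sum_distrib_right)
      finally have "\<bar>ap m x - ap m x'\<bar> \<le> (1 + E * c) * T" using T(1) by (simp add: algebra_simps)
      then have s: "\<bar>s\<bar> \<le> (1 + E * c) / \<bar>ap m z\<bar> * T"
        unfolding s_def by (simp add: abs_divide divide_right_mono)
      have "ap i (\<lambda>j. x' j + s * z j) = ap i x" if "i < Suc m" for i
        unfolding ap_add using x'(1) z that by (cases "i = m") (auto simp: s_def)
      moreover have "\<bar>x' j + s * z j\<bar> \<le> c' * T" if "j < n" for j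
      proof -
        have "\<bar>z j\<bar> \<le> Z" unfolding Z_def using that by (intro member_le_sum) auto
        then have "\<bar>s\<bar> * \<bar>z j\<bar> \<le> ((1 + E * c) / \<bar>ap m z\<bar> * T) * Z"
          using s nn c T0 by (intro mult_mono) auto
        then have "\<bar>x' j + s * z j\<bar> \<le> c * T + ((1 + E * c) / \<bar>ap m z\<bar> * T) * Z"
          using x'T[OF that] abs_triangle_ineq[of "x' j" "s * z j"] by (simp add: abs_mult)
        also have "\<dots> = c' * T" unfolding c'_def by (simp only: distrib_right) (simp add: mult_ac)
        finally show ?thesis .
      qed
      ultimately show ?thesis unfolding T_def by (intro exI[of _ "\<lambda>j. x' j + s * z j"]) blast
    qed
    ultimately show ?thesis unfolding ap_def by blast
  qed
qed

text \<open>Replace \<open>x\<close> by a preimage \<open>x'\<close> of the same residual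
  \<open>S x\<close> whose size the residual controls. By symmetry
  \<open>x^T S x = x^T S x' = x'^T S x\<close>, which is at most the size of \<open>x'\<close> times
  that of the residual.\<close>

lemma qform_bounded_by_residual:
  assumes sym: "\<And>i j. S i j = S j i"
  shows "\<exists>c\<ge>0. \<forall>x. \<bar>qform n S x\<bar> \<le> c * (\<Sum>i<n. \<bar>\<Sum>j<n. S i j * x j\<bar>)\<^sup>2"
proof -
  define r where "r x i = (\<Sum>j<n. S i j * x j)" for x i
  obtain c where c: "c \<ge> 0" and ex: "\<And>x. \<exists>x'. (\<forall>i<n. r x' i = r x i) \<and> (\<forall>j<n. \<bar>x' j\<bar> \<le> c * (\<Sum>i<n. \<bar>r x i\<bar>))"
    using bounded_preimage[where m = n and n = n and A = S] unfolding r_def by blast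
  have "\<bar>qform n S x\<bar> \<le> c * (\<Sum>i<n. \<bar>r x i\<bar>)\<^sup>2" for x
  proof -
    obtain x' where x': "\<forall>i<n. r x' i = r x i" "\<forall>j<n. \<bar>x' j\<bar> \<le> c * (\<Sum>i<n. \<bar>r x i\<bar>)"
      using ex by blast
    have "qform n S x = (\<Sum>i<n. x i * r x i)"
      by (simp add: qform_def r_def sum_distrib_left mult.assoc)
    also have "\<dots> = (\<Sum>i<n. x i * r x' i)" using x'(1) by simp
    also have "\<dots> = (\<Sum>j<n. \<Sum>i<n. x' j * (S i j * x i))"
      unfolding r_def sum_distrib_left by (subst sum.swap) (simp add: mult_ac)
    also have "\<dots> = (\<Sum>j<n. x' j * r x j)"
      unfolding r_def sum_distrib_left using sym by (intro sum.cong refl) metis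
    also have "\<bar>\<dots>\<bar> \<le> (\<Sum>j<n. \<bar>x' j\<bar> * \<bar>r x j\<bar>)"
      by (rule order_trans[OF sum_abs]) (simp add: abs_mult)
    also have "\<dots> \<le> (\<Sum>j<n. (c * (\<Sum>i<n. \<bar>r x i\<bar>)) * \<bar>r x j\<bar>)"
      using x'(2) by (intro sum_mono mult_right_mono) auto
    also have "\<dots> = c * (\<Sum>i<n. \<bar>r x i\<bar>)\<^sup>2"
      by (simp add: sum_distrib_left[symmetric] power2_eq_square)
    finally show ?thesis .
  qed
  then show ?thesis using c unfolding r_def by blast
qed

section \<open>Energy decrease and growth under sweeps\<close>

context
  fixes n :: nat and C S :: "nat \<Rightarrow> nat \<Rightarrow> real" and y :: "nat \<Rightarrow> real"
  assumes sym: "\<And>i j. C i j = C j i" and diag: "\<And>i. C i i = 0"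
    and S: "\<And>i j. S i j = C i j + (if i = j then y i else 0)"
begin

lemma gs_S_sym: "S i j = S j i"
  using sym by (auto simp: S)

lemma gs_residual:
  assumes "i < n"
  shows "(\<Sum>j<n. S i j * x j) = (\<Sum>j<n. C i j * x j) + y i * x i"
  using assms by (simp add: S distrib_right sum.distrib if_distrib[of "\<lambda>z. z * _"] cong: if_cong)

text \<open>As \<open>S i i = y i\<close>, each step minimizes the form exactly in one coordinate
  and lowers it by \<open>y i\<close> times the square of the change. Coordinate \<open>j\<close> is
  final once it has been updated, so the changes can be read off the full sweep.\<close>

lemma gs_energy:
  assumes y: "\<And>i. i < n \<Longrightarrow> y i > 0" and m: "m \<le> n"
  shows "qform n S (gs_partial n C y m x)
    = qform n S x - (\<Sum>j<m. y j * (x j - gs_partial n C y n x j)\<^sup>2)"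
  using m
proof (induction m)
  case 0
  then show ?case by (simp add: gs_partial_0)
next
  case (Suc m)
  let ?X = "gs_partial n C y m x"
  define t where "t = - (\<Sum>j<n. C m j * ?X j) / y m"
  have Xm: "?X m = x m" by (simp add: gs_partial_ge)
  have t: "gs_partial n C y n x m = t"
    using gs_partial_stable[of "Suc m" n m n C y x] Suc.prems
    by (simp add: gs_partial_Suc gs_step_def t_def)
  have r: "(\<Sum>j<n. S m j * ?X j) = - y m * (t - x m)"
    using gs_residual[of m ?X] y[of m] Suc.prems Xm by (simp add: t_def field_simps)
  have "gs_partial n C y (Suc m) x = ?X(m := ?X m + (t - x m))"
    by (simp add: gs_partial_Suc gs_step_def t_def Xm)
  then have "qform n S (gs_partial n C y (Suc m) x)
      = qform n S ?X + 2 * (t - x m) * (- y m * (t - x m)) + (t - x m)\<^sup>2 * S m m"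
    using qform_update[of S m n ?X "t - x m"] gs_S_sym Suc.prems r by simp
  moreover have "S m m = y m" by (simp add: S diag)
  ultimately show ?case
    using Suc t by (simp add: power2_eq_square algebra_simps)
qed

text \<open>Just before coordinate \<open>i\<close> is updated, row \<open>i\<close> of the residual
  is \<open>y i\<close> times the change about to be made. The iterate at that moment differs from
  \<open>x\<close> only in coordinates below \<open>i\<close>, by changes of the same sweep.\<close>

lemma gs_residual_bound:
  assumes y: "\<And>i. i < n \<Longrightarrow> y i > 0"
  shows "\<exists>K\<ge>0. \<forall>x. (\<Sum>i<n. \<bar>\<Sum>j<n. S i j * x j\<bar>) \<le> K * (\<Sum>j<n. \<bar>x j - gs_partial n C y n x j\<bar>)"
proof -
  define K where "K i = y i + (\<Sum>j<n. \<bar>S i j\<bar>)" for i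
  have "(\<Sum>i<n. \<bar>\<Sum>j<n. S i j * x j\<bar>) \<le> (\<Sum>i<n. K i) * (\<Sum>j<n. \<bar>x j - gs_partial n C y n x j\<bar>)" for x
    unfolding sum_distrib_right
  proof (rule sum_mono)
    fix i assume "i \<in> {..<n}"
    then have i: "i < n" by simp
    let ?X = "gs_partial n C y i x"
    define d where "d j = x j - gs_partial n C y n x j" for j
    define D where "D = (\<Sum>j<n. \<bar>d j\<bar>)"
    have dD: "\<bar>d j\<bar> \<le> D" if "j < n" for j unfolding D_def using that by (intro member_le_sum) auto
    then have D0: "D \<ge> 0" using i by fastforce
    have "gs_partial n C y n x i = - (\<Sum>j<n. C i j * ?X j) / y i"
      using gs_partial_stable[of "Suc i" n i n C y x] i by (simp add: gs_partial_Suc gs_step_def)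
    then have 1: "(\<Sum>j<n. S i j * ?X j) = y i * d i"
      using gs_residual[OF i, of ?X] y[OF i] by (simp add: d_def gs_partial_ge field_simps)
    have xX: "x j = ?X j + (if j < i then d j else 0)" for j
      using gs_partial_stable[of i n j n C y x] gs_partial_ge[of i j n C y x] i by (auto simp: d_def)
    have "(\<Sum>j<n. S i j * x j) = (\<Sum>j<n. S i j * ?X j + S i j * (if j < i then d j else 0))"
      by (intro sum.cong refl) (subst xX, simp add: distrib_left)
    then have "(\<Sum>j<n. S i j * x j) = y i * d i + (\<Sum>j<n. S i j * (if j < i then d j else 0))"
      using 1 by (simp add: sum.distrib)
    then have "\<bar>\<Sum>j<n. S i j * x j\<bar> \<le> \<bar>y i * d i\<bar> + (\<Sum>j<n. \<bar>S i j * (if j < i then d j else 0)\<bar>)"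
      using abs_triangle_ineq[of "y i * d i"] sum_abs[of "\<lambda>j. S i j * (if j < i then d j else 0)" "{..<n}"]
      by linarith
    also have "\<dots> \<le> y i * D + (\<Sum>j<n. \<bar>S i j\<bar> * D)"
      using y[OF i] dD i D0 unfolding abs_mult
      by (intro add_mono sum_mono mult_mono) auto
    also have "\<dots> = K i * D" by (simp add: K_def distrib_right sum_distrib_right)
    finally show "\<bar>\<Sum>j<n. S i j * x j\<bar> \<le> K i * (\<Sum>j<n. \<bar>x j - gs_partial n C y n x j\<bar>)"
      by (simp add: D_def d_def)
  qed
  moreover have "(\<Sum>i<n. K i) \<ge> 0"
    unfolding K_def using y by (intro sum_nonneg add_nonneg_nonneg) (auto intro: less_imp_le)
  ultimately show ?thesis by blast
qed

text \<open>With \<open>d\<close> the change made by the sweep, the energy drop is at least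
  \<open>\<mu>\<close> times the sum of \<open>(d j)^2\<close>, while the residual estimates bound
  the absolute value of the form by a constant multiple of the same sum.\<close>

lemma gs_contraction:
  assumes \<mu>: "\<mu> > 0" "\<And>i. i < n \<Longrightarrow> y i \<ge> \<mu>"
  shows "\<exists>\<epsilon>>0. \<forall>x. qform n S (gs_partial n C y n x) \<le> qform n S x - \<epsilon> * \<bar>qform n S x\<bar>"
proof -
  have y: "\<And>i. i < n \<Longrightarrow> y i > 0" using \<mu> by force
  obtain c where c: "c \<ge> 0" "\<And>x. \<bar>qform n S x\<bar> \<le> c * (\<Sum>i<n. \<bar>\<Sum>j<n. S i j * x j\<bar>)\<^sup>2"
    using qform_bounded_by_residual[of S n] gs_S_sym by blast
  obtain K where K: "K \<ge> 0"
    "\<And>x. (\<Sum>i<n. \<bar>\<Sum>j<n. S i j * x j\<bar>) \<le> K * (\<Sum>j<n. \<bar>x j - gs_partial n C y n x j\<bar>)"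
    using gs_residual_bound y by blast
  \<comment> \<open>The summand 1 keeps \<open>B\<close> positive when the other term is 0.\<close>
  define B where "B = c * K\<^sup>2 * real n / \<mu> + 1"
  have B: "B > 0" unfolding B_def using c K \<mu> by (intro add_nonneg_pos) auto
  have "qform n S (gs_partial n C y n x) \<le> qform n S x - 1 / B * \<bar>qform n S x\<bar>" for x
  proof -
    define d where "d j = x j - gs_partial n C y n x j" for j
    define W where "W = (\<Sum>j<n. y j * (d j)\<^sup>2)"
    have W0: "W \<ge> 0" unfolding W_def using y by (intro sum_nonneg mult_nonneg_nonneg) (auto intro: less_imp_le)
    have "\<mu> * (\<Sum>j<n. (d j)\<^sup>2) \<le> W"
      unfolding W_def sum_distrib_left using \<mu> by (intro sum_mono mult_right_mono) auto
    then have dW: "(\<Sum>j<n. (d j)\<^sup>2) \<le> W / \<mu>" using \<mu>(1) by (simp add: pos_le_divide_eq mult.commute)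
    have "\<bar>qform n S x\<bar> \<le> c * (\<Sum>i<n. \<bar>\<Sum>j<n. S i j * x j\<bar>)\<^sup>2" by (rule c(2))
    also have "\<dots> \<le> c * (K * (\<Sum>j<n. \<bar>d j\<bar>))\<^sup>2"
      using K(2)[of x] c(1) unfolding d_def by (intro mult_left_mono power_mono) (auto simp: sum_nonneg)
    also have "\<dots> = c * K\<^sup>2 * (\<Sum>j<n. \<bar>d j\<bar>)\<^sup>2" by (simp add: power_mult_distrib)
    also have "\<dots> \<le> c * K\<^sup>2 * (real n * (\<Sum>j<n. (d j)\<^sup>2))"
      using sum_squared_le_sum_of_squares[of "\<lambda>j. \<bar>d j\<bar>" "{..<n}"] c(1)
      by (intro mult_left_mono) (auto simp: mult.commute)
    also have "\<dots> \<le> c * K\<^sup>2 * (real n * (W / \<mu>))"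
      using dW c(1) by (intro mult_left_mono) auto
    also have "\<dots> \<le> B * W" unfolding B_def using W0 by (simp add: distrib_right)
    finally have "1 / B * \<bar>qform n S x\<bar> \<le> W" using B by (simp add: pos_divide_le_eq mult.commute)
    then show ?thesis
      using gs_energy[OF y, of n x] by (simp add: W_def d_def)
  qed
  then show ?thesis using B by (intro exI[of _ "1 / B"]) auto
qed

lemma gs_geometric_growth:
  assumes \<mu>: "\<mu> > 0" "\<And>i. i < n \<Longrightarrow> y i \<ge> \<mu>" and x: "qform n S x < 0"
  shows "\<exists>\<rho>>1. \<forall>t. qform n S ((gs_partial n C y n ^^ t) x) \<le> \<rho> ^ t * qform n S x"
proof -
  obtain \<epsilon> where \<epsilon>: "\<epsilon> > 0"
    and dec: "\<And>x. qform n S (gs_partial n C y n x) \<le> qform n S x - \<epsilon> * \<bar>qform n S x\<bar>"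
    using gs_contraction[OF \<mu>] by blast
  have "qform n S ((gs_partial n C y n ^^ t) x) \<le> (1 + \<epsilon>) ^ t * qform n S x" for t
  proof (induction t)
    case (Suc t)
    let ?q = "qform n S ((gs_partial n C y n ^^ t) x)"
    have "(1 + \<epsilon>) ^ t * qform n S x < 0" using x \<epsilon> by (simp add: mult_pos_neg)
    then have "?q < 0" using Suc by linarith
    then have "qform n S ((gs_partial n C y n ^^ Suc t) x) \<le> (1 + \<epsilon>) * ?q"
      using dec[of "(gs_partial n C y n ^^ t) x"] by (simp add: distrib_right)
    also have "\<dots> \<le> (1 + \<epsilon>) * ((1 + \<epsilon>) ^ t * qform n S x)"
      using Suc \<epsilon> by (intro mult_left_mono) auto
    finally show ?case by (simp add: mult.assoc)
  qed simp
  then show ?thesis using \<epsilon> by (intro exI[of _ "1 + \<epsilon>"]) auto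
qed

end

section \<open>Linearization of the Mixing map\<close>

lemma mix_step_critical:
  assumes "first_order_critical n k C V" "i < n" "gnorm n k C V i > 0"
  shows "mix_step n k C i V = V"
  using assms by (intro ext) (auto simp: mix_step_def first_order_critical_def)

lemma mix_partial_Suc: "mix_partial n k C (Suc m) V = mix_step n k C m (mix_partial n k C m V)"
  by (simp add: mix_partial_def)

text \<open>Non-degeneracy speaks of the intermediate iterates. By induction these all equal
  \<open>V\<close>: the bound makes the next normalization legitimate, and criticality then makes
  the step a fixed one.\<close>

lemma nondegenerate_gnorm_ge:
  assumes "first_order_critical n k C V" "nondegenerate n k C V"
  shows "\<exists>\<delta>>0. \<forall>i<n. gnorm n k C V i \<ge> \<delta>"
proof -
  obtain \<delta> where \<delta>: "\<delta> > 0" "\<And>i. i < n \<Longrightarrow> gnorm n k C (mix_partial n k C i V) i \<ge> \<delta>"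
    using assms(2) unfolding nondegenerate_def by blast
  have "mix_partial n k C m V = V" if "m \<le> n" for m
    using that
  proof (induction m)
    case 0
    then show ?case by (simp add: mix_partial_def)
  next
    case (Suc m)
    then have mp: "mix_partial n k C m V = V" by simp
    then have "gnorm n k C V m > 0" using \<delta>(1) \<delta>(2)[of m] Suc.prems by simp
    then show ?case using mix_step_critical[OF assms(1)] mp Suc.prems by (simp add: mix_partial_Suc)
  qed
  then show ?thesis using \<delta> by (metis less_imp_le)
qed

section \<open>Derivative in rank-one directions orthogonal to the columns\<close>

context
  fixes n k :: nat and C V :: "nat \<Rightarrow> nat \<Rightarrow> real"
  assumes crit: "first_order_critical n k C V"
    and pos: "\<And>i. i < n \<Longrightarrow> gnorm n k C V i > 0"
begin

lemma mix_partial_critical: "m \<le> n \<Longrightarrow> mix_partial n k C m V = V"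
  by (induction m) (simp_all add: mix_partial_def mix_step_critical[OF crit _ pos])

text \<open>Induction over the coordinate updates. Along \<open>u x^T\<close> the derivative of
  \<open>gvec\<close> in row \<open>m\<close> is a multiple of \<open>u\<close>. Since
  \<open>u\<close> is orthogonal to column \<open>m\<close>, the normalization contributes nothing
  and the update acts on \<open>x\<close> as \<open>gs_step\<close>.\<close>

lemma mix_partial_linearization:
  assumes u: "\<And>j. j < n \<Longrightarrow> (\<Sum>a<k. u a * V a j) = 0" and m: "m \<le> n"
  shows "\<exists>d. (\<forall>b j a i. a < k \<longrightarrow> i < n \<longrightarrow>
        ((\<lambda>t. mix_partial n k C m (perturb V b j t) a i) has_real_derivative d b j a i) (at 0)) \<and>
      (\<forall>a<k. \<forall>i<n. \<forall>x. (\<Sum>b<k. \<Sum>j<n. d b j a i * (u b * x j)) = u a * gs_partial n C (gnorm n k C V) m x i)"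
  using m
proof (induction m)
  case 0
  define d :: "nat \<Rightarrow> nat \<Rightarrow> nat \<Rightarrow> nat \<Rightarrow> real" where "d b j a i = (if a = b \<and> i = j then 1 else 0)" for b j a i
  have "((\<lambda>t. mix_partial n k C 0 (perturb V b j t) a i) has_real_derivative d b j a i) (at 0)" for b j a i
    by (auto simp: mix_partial_def perturb_def d_def intro!: derivative_eq_intros)
  moreover have "(\<Sum>b<k. \<Sum>j<n. d b j a i * (u b * x j)) = u a * gs_partial n C (gnorm n k C V) 0 x i"
    if "a < k" "i < n" for a i x
  proof -
    have "(\<Sum>j<n. d b j a i * (u b * x j)) = (if b = a then u b * x i else 0)" for b
      using that by (cases "b = a") (auto simp: d_def if_distrib[of "\<lambda>z. z * _"] cong: if_cong)
    then show ?thesis using that by (simp add: gs_partial_0)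
  qed
  ultimately show ?case by blast
next
  case (Suc m)
  let ?y = "gnorm n k C V" and ?G = "gs_partial n C (gnorm n k C V)"
  have mn: "m < n" using Suc.prems by simp
  obtain d where der: "\<And>b j a i. a < k \<Longrightarrow> i < n \<Longrightarrow>
        ((\<lambda>t. mix_partial n k C m (perturb V b j t) a i) has_real_derivative d b j a i) (at 0)"
    and lin: "\<And>a i x. a < k \<Longrightarrow> i < n \<Longrightarrow> (\<Sum>b<k. \<Sum>j<n. d b j a i * (u b * x j)) = u a * ?G m x i"
    using Suc.IH[OF Suc_leD[OF Suc.prems]] by blast
  have at0: "mix_partial n k C m (perturb V b j 0) = V" for b j
  proof -
    have "perturb V b j 0 = V" by (intro ext) (simp add: perturb_def)
    then show ?thesis using mix_partial_critical Suc.prems by simp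
  qed
  define g' where "g' b j a = (\<Sum>l<n. C m l * d b j a l)" for b j a
  \<comment> \<open>Derivative of \<open>- g / norm g\<close> at the critical point:
    \<open>- g' / y\<close> projected orthogonally to column \<open>m\<close>.\<close>
  define h' where "h' b j a = - (g' b j a - V a m * (\<Sum>p<k. V p m * g' b j p)) / ?y m" for b j a
  define d' where "d' b j a i = (if i = m then h' b j a else d b j a i)" for b j a i
  have y: "?y m > 0" using pos mn by simp
  have gV: "gvec n C V m a = - ?y m * V a m" if "a < k" for a
    using crit mn that by (simp add: first_order_critical_def)
  have "((\<lambda>t. mix_partial n k C (Suc m) (perturb V b j t) a i) has_real_derivative d' b j a i) (at 0)"
    if a: "a < k" and i: "i < n" for b j a i
  proof (cases "i = m")
    case False
    then show ?thesis using der[OF a i] by (simp add: mix_partial_def mix_step_def d'_def)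
  next
    case True
    let ?W = "\<lambda>t. mix_partial n k C m (perturb V b j t)"
    have dg: "((\<lambda>t. gvec n C (?W t) m p) has_real_derivative g' b j p) (at 0)" if "p < k" for p
      unfolding gvec_def g'_def using der[OF that] by (intro DERIV_sum DERIV_cmult) auto
    have dsq: "((\<lambda>t. \<Sum>p<k. (gvec n C (?W t) m p)\<^sup>2) has_real_derivative
        (\<Sum>p<k. 2 * gvec n C V m p * g' b j p)) (at 0)"
    proof (rule DERIV_sum)
      fix p assume "p \<in> {..<k}"
      then have "((\<lambda>t. (gvec n C (?W t) m p)\<^sup>2) has_real_derivative
          of_nat 2 * (gvec n C (?W 0) m p) ^ (2 - 1) * g' b j p) (at 0)"
        using dg[of p] by (auto intro!: derivative_eq_intros)
      then show "((\<lambda>t. (gvec n C (?W t) m p)\<^sup>2) has_real_derivative 2 * gvec n C V m p * g' b j p) (at 0)"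
        by (simp add: at0)
    qed
    have N2: "(\<Sum>p<k. (gvec n C (?W 0) m p)\<^sup>2) > 0"
      using y unfolding gnorm_def at0 by simp
    \<comment> \<open>Criticality replaces \<open>g\<close> by \<open>- y\<close> times column
      \<open>m\<close>, so the derivative of the norm becomes minus the inner product of that column
      with \<open>g'\<close>.\<close>
    have "(\<Sum>p<k. 2 * gvec n C V m p * g' b j p) = - 2 * ?y m * (\<Sum>p<k. V p m * g' b j p)"
      unfolding sum_distrib_left by (intro sum.cong refl) (simp add: gV)
    then have "((\<lambda>t. gnorm n k C (?W t) m) has_real_derivative
        inverse (sqrt (\<Sum>p<k. (gvec n C (?W 0) m p)\<^sup>2)) / 2 * (- 2 * ?y m * (\<Sum>p<k. V p m * g' b j p))) (at 0)"
      using DERIV_chain2[OF DERIV_real_sqrt[OF N2] dsq] unfolding gnorm_def by simp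
    moreover have "sqrt (\<Sum>p<k. (gvec n C (?W 0) m p)\<^sup>2) = ?y m" by (simp add: gnorm_def at0)
    ultimately have dN: "((\<lambda>t. gnorm n k C (?W t) m) has_real_derivative - (\<Sum>p<k. V p m * g' b j p)) (at 0)"
      using y by (simp add: field_simps)
    have "((\<lambda>t. - gvec n C (?W t) m a / gnorm n k C (?W t) m) has_real_derivative
       (- g' b j a * gnorm n k C (?W 0) m - (- gvec n C (?W 0) m a) * (- (\<Sum>p<k. V p m * g' b j p)))
        / (gnorm n k C (?W 0) m * gnorm n k C (?W 0) m)) (at 0)"
      using y by (intro DERIV_divide DERIV_minus dg[OF a] dN) (simp add: at0)
    moreover have "(- g' b j a * ?y m - (- (- ?y m * V a m)) * (- (\<Sum>p<k. V p m * g' b j p)))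
        / (?y m * ?y m) = h' b j a"
      unfolding h'_def using y by (simp add: field_simps)
    ultimately have "((\<lambda>t. - gvec n C (?W t) m a / gnorm n k C (?W t) m) has_real_derivative h' b j a) (at 0)"
      unfolding at0 gV[OF a] by simp
    then show ?thesis using a True by (simp add: mix_partial_def mix_step_def d'_def)
  qed
  moreover have "(\<Sum>b<k. \<Sum>j<n. d' b j a i * (u b * x j)) = u a * ?G (Suc m) x i"
    if a: "a < k" and i: "i < n" for a i x
  proof (cases "i = m")
    case False
    then show ?thesis using lin[OF a i] by (simp add: d'_def gs_partial_Suc gs_step_def)
  next
    case True
    define r where "r = (\<Sum>l<n. C m l * ?G m x l)"
    \<comment> \<open>For partial derivatives \<open>f b j\<close> this is the directional
      derivative along \<open>u x^T\<close>.\<close>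
    define avg where "avg f = (\<Sum>b<k. \<Sum>j<n. f b j * (u b * x j))" for f
    have avg_cmult: "avg (\<lambda>b j. c * f b j) = c * avg f" for c f
      by (simp add: avg_def sum_distrib_left mult.assoc)
    have avg_sum: "avg (\<lambda>b j. \<Sum>l<q. f l b j) = (\<Sum>l<q. avg (f l))" for f and q :: nat
    proof -
      have "avg (\<lambda>b j. \<Sum>l<q. f l b j) = (\<Sum>b<k. \<Sum>l<q. \<Sum>j<n. f l b j * (u b * x j))"
        unfolding avg_def sum_distrib_right by (rule sum.cong[OF refl], rule sum.swap)
      also have "\<dots> = (\<Sum>l<q. avg (f l))" unfolding avg_def by (rule sum.swap)
      finally show ?thesis .
    qed
    have avg_diff: "avg (\<lambda>b j. f b j - g b j) = avg f - avg g" for f g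
      by (simp add: avg_def left_diff_distrib sum_subtractf)
    have g: "avg (\<lambda>b j. g' b j p) = u p * r" if "p < k" for p
    proof -
      have "avg (\<lambda>b j. g' b j p) = (\<Sum>l<n. C m l * avg (\<lambda>b j. d b j p l))"
        unfolding g'_def avg_sum avg_cmult ..
      also have "\<dots> = (\<Sum>l<n. C m l * (u p * ?G m x l))"
        using lin[OF that] by (intro sum.cong refl) (simp add: avg_def)
      finally show ?thesis by (simp add: r_def sum_distrib_left mult_ac)
    qed
    have h: "h' b j a = (- 1 / ?y m) * (g' b j a - V a m * (\<Sum>p<k. V p m * g' b j p))" for b j
      using y by (simp add: h'_def field_simps)
    have "avg (\<lambda>b j. h' b j a) = (- 1 / ?y m) * (u a * r - V a m * (\<Sum>p<k. V p m * (u p * r)))"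
      unfolding h avg_cmult avg_diff avg_sum using g a by simp
    also have "(\<Sum>p<k. V p m * (u p * r)) = (\<Sum>p<k. u p * V p m) * r"
      by (simp add: sum_distrib_left mult_ac)
    also have "\<dots> = 0" using u[OF mn] by simp
    finally show ?thesis
      using True by (simp add: d'_def gs_partial_Suc gs_step_def avg_def r_def)
  qed
  ultimately show ?case by blast
qed

end

section \<open>Spectral radius and geometric growth\<close>

lemma sum_div_mod:
  fixes h :: "nat \<Rightarrow> nat \<Rightarrow> 'a::comm_monoid_add"
  shows "(\<Sum>q<k * n. h (q div n) (q mod n)) = (\<Sum>b<k. \<Sum>j<n. h b j)"
proof (cases "n = 0")
  case False
  have "(\<Sum>q<k * n. h (q div n) (q mod n)) = (\<Sum>b<k. \<Sum>q\<in>{b * n..<b * n + n}. h (q div n) (q mod n))"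
    by (rule sum.nat_group[symmetric])
  also have "\<dots> = (\<Sum>b<k. \<Sum>j<n. h b j)"
  proof (rule sum.cong[OF refl])
    fix b
    have "(\<Sum>j<n. h ((b * n + j) div n) ((b * n + j) mod n)) = (\<Sum>q\<in>{b * n..<b * n + n}. h (q div n) (q mod n))"
      by (rule sum.reindex_bij_witness[of _ "\<lambda>q. q - b * n" "\<lambda>j. b * n + j"]) auto
    then show "(\<Sum>q\<in>{b * n..<b * n + n}. h (q div n) (q mod n)) = (\<Sum>j<n. h b j)"
      by simp
  qed
  finally show ?thesis .
qed simp

section \<open>Polynomial against exponential growth\<close>

lemma power_over_exponential:
  fixes \<rho> :: real
  assumes "\<rho> > 1"
  shows "(\<lambda>t. real t ^ d / \<rho> ^ t) \<longlonglongrightarrow> 0"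
proof -
  have ln: "ln \<rho> > 0" using assms by simp
  have "filterlim (\<lambda>t. ln \<rho> * real t) at_top sequentially"
    using ln by (intro filterlim_tendsto_pos_mult_at_top[OF tendsto_const] filterlim_real_sequentially) auto
  then have "(\<lambda>t. (ln \<rho> * real t) ^ d / exp (ln \<rho> * real t)) \<longlonglongrightarrow> 0"
    by (rule filterlim_compose[OF tendsto_power_div_exp_0])
  then have "(\<lambda>t. 1 / ln \<rho> ^ d * ((ln \<rho> * real t) ^ d / exp (ln \<rho> * real t))) \<longlonglongrightarrow> 1 / ln \<rho> ^ d * 0"
    by (intro tendsto_mult tendsto_const)
  moreover have "exp (ln \<rho> * real t) = \<rho> ^ t" for t
    using assms by (simp add: exp_of_nat2_mult)
  ultimately show ?thesis
    using ln by (simp add: power_mult_distrib)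
qed

lemma poly_over_exponential:
  fixes \<rho> a b :: real
  assumes "\<rho> > 1"
  shows "(\<lambda>t. (a + b * real t ^ d)\<^sup>2 / \<rho> ^ t) \<longlonglongrightarrow> 0"
proof -
  have eq: "(a + b * real t ^ d)\<^sup>2 / \<rho> ^ t
      = a\<^sup>2 * (real t ^ 0 / \<rho> ^ t) + 2 * a * b * (real t ^ d / \<rho> ^ t) + b\<^sup>2 * (real t ^ (d + d) / \<rho> ^ t)" for t
    using assms by (simp add: field_simps power2_eq_square power_add)
  have "(\<lambda>t. a\<^sup>2 * (real t ^ 0 / \<rho> ^ t) + 2 * a * b * (real t ^ d / \<rho> ^ t) + b\<^sup>2 * (real t ^ (d + d) / \<rho> ^ t))
      \<longlonglongrightarrow> a\<^sup>2 * 0 + 2 * a * b * 0 + b\<^sup>2 * 0"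
    by (intro tendsto_add tendsto_mult tendsto_const power_over_exponential assms)
  then show ?thesis unfolding eq by simp
qed

lemma pow_mat_mult_vec_Suc:
  fixes A :: "'a::comm_semiring_1 mat"
  assumes "A \<in> carrier_mat N N" "v \<in> carrier_vec N"
  shows "(A ^\<^sub>m Suc t) *\<^sub>v v = (A ^\<^sub>m t) *\<^sub>v (A *\<^sub>v v)"
  using assms by (simp add: assoc_mult_mat_vec[of _ N N _ N])

lemma qform_abs_le:
  assumes "\<And>i. i < n \<Longrightarrow> \<bar>x i\<bar> \<le> b"
  shows "\<bar>qform n S x\<bar> \<le> (\<Sum>i<n. \<Sum>j<n. \<bar>S i j\<bar>) * b\<^sup>2"
proof -
  have "\<bar>qform n S x\<bar> \<le> (\<Sum>i<n. \<Sum>j<n. \<bar>x i * S i j * x j\<bar>)"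
    unfolding qform_def by (rule order_trans[OF sum_abs]) (intro sum_mono sum_abs)
  also have "\<dots> \<le> (\<Sum>i<n. \<Sum>j<n. \<bar>S i j\<bar> * b\<^sup>2)"
  proof (intro sum_mono)
    fix i j assume "i \<in> {..<n}" "j \<in> {..<n}"
    then have "\<bar>x i\<bar> * \<bar>x j\<bar> \<le> b * b"
      using assms by (intro mult_mono) (auto intro: order_trans[OF abs_ge_zero])
    then have "\<bar>S i j\<bar> * (\<bar>x i\<bar> * \<bar>x j\<bar>) \<le> \<bar>S i j\<bar> * (b * b)"
      by (intro mult_left_mono) auto
    then show "\<bar>x i * S i j * x j\<bar> \<le> \<bar>S i j\<bar> * b\<^sup>2"
      by (simp add: abs_mult power2_eq_square mult_ac)
  qed
  finally show ?thesis by (simp add: sum_distrib_right)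
qed

text \<open>With spectral radius at most 1 the entries of the powers of \<open>A\<close> grow
  polynomially, hence so does the quadratic form along the iterates of \<open>G\<close>, against the
  factor \<open>\<rho> ^ t\<close>. The map \<open>z\<close> intertwines \<open>G\<close> with
  \<open>A\<close>, and the coordinates \<open>p i\<close> recover \<open>x\<close> up to sign and
  the factor \<open>c\<close>.\<close>

lemma spectral_radius_gt_1_if_growth:
  fixes A :: "complex mat" and z :: "(nat \<Rightarrow> real) \<Rightarrow> complex vec"
  assumes A: "A \<in> carrier_mat N N"
    and z: "\<And>x. z x \<in> carrier_vec N" "\<And>x. A *\<^sub>v z x = z (G x)"
    and c: "\<And>i. i < n \<Longrightarrow> p i < N" "\<And>x i. i < n \<Longrightarrow> norm (z x $ p i) = c * \<bar>x i\<bar>" "c > 0"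
    and \<rho>: "\<rho> > 1" and grow: "\<And>t. qform n S ((G ^^ t) x) \<le> \<rho> ^ t * qform n S x"
    and neg: "qform n S x < 0"
  shows "spectral_radius A > 1"
proof (rule ccontr)
  assume "\<not> ?thesis"
  then have sr: "spectral_radius A \<le> 1" by simp
  \<comment> \<open>A common bound on the algebraic multiplicities of eigenvalues provides the
    exponent of the polynomial growth.\<close>
  have "char_poly A \<noteq> 0" using degree_monic_char_poly[OF A] by auto
  then have "Polynomial.order ev (char_poly A) \<le> degree (char_poly A)" for ev
    by (rule order_degree)
  then obtain c1 c2 d where bound: "\<And>t. norm_bound (A ^\<^sub>m t) (c1 + c2 * of_nat t ^ d)"
    using spectral_radius_poly_bound[OF A sr] by blast
  have Az: "(A ^\<^sub>m t) *\<^sub>v z x = z ((G ^^ t) x)" for t x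
  proof (induction t arbitrary: x)
    case 0
    then show ?case using z(1)[of x] A by simp
  next
    case (Suc t)
    show ?case
      unfolding pow_mat_mult_vec_Suc[OF A z(1)] z(2) Suc funpow_Suc_right by simp
  qed
  define Z where "Z = (\<Sum>q<N. norm (z x $ q))"
  have le: "\<bar>(G ^^ t) x i\<bar> \<le> (c1 + c2 * real t ^ d) * Z / c" if i: "i < n" for t i
  proof -
    have At: "A ^\<^sub>m t \<in> carrier_mat N N" using A by simp
    have "z ((G ^^ t) x) $ p i = (\<Sum>q<N. (A ^\<^sub>m t) $$ (p i, q) * z x $ q)"
      unfolding Az[symmetric] using carrier_matD[OF At] carrier_vecD[OF z(1)[of x]] c(1)[OF i]
      by (simp add: scalar_prod_def atLeast0LessThan del: pow_mat_dim)
    then have "c * \<bar>(G ^^ t) x i\<bar> = norm (\<Sum>q<N. (A ^\<^sub>m t) $$ (p i, q) * z x $ q)"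
      using c(2)[OF i] by metis
    also have "\<dots> \<le> (\<Sum>q<N. norm ((A ^\<^sub>m t) $$ (p i, q)) * norm (z x $ q))"
      by (rule order_trans[OF norm_sum]) (simp add: norm_mult)
    also have "\<dots> \<le> (\<Sum>q<N. (c1 + c2 * real t ^ d) * norm (z x $ q))"
      using bound[of t] c(1)[OF i] unfolding norm_bound_def carrier_matD[OF At]
      by (intro sum_mono mult_right_mono) auto
    also have "\<dots> = (c1 + c2 * real t ^ d) * Z" by (simp add: Z_def sum_distrib_left)
    finally show ?thesis using c(3) by (simp add: pos_le_divide_eq mult.commute)
  qed
  define B where "B = (\<Sum>i<n. \<Sum>j<n. \<bar>S i j\<bar>) * (Z / c)\<^sup>2"
  have "\<bar>qform n S x\<bar> \<le> B * ((c1 + c2 * real t ^ d)\<^sup>2 / \<rho> ^ t)" for t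
  proof -
    have "qform n S ((G ^^ t) x) \<le> 0"
      using grow[of t] neg \<rho> by (smt (verit) mult_pos_neg zero_less_power)
    then have "\<rho> ^ t * \<bar>qform n S x\<bar> \<le> \<bar>qform n S ((G ^^ t) x)\<bar>"
      using grow[of t] neg by simp
    also have "\<dots> \<le> (\<Sum>i<n. \<Sum>j<n. \<bar>S i j\<bar>) * ((c1 + c2 * real t ^ d) * Z / c)\<^sup>2"
      by (rule qform_abs_le) (rule le)
    also have "\<dots> = B * (c1 + c2 * real t ^ d)\<^sup>2"
      by (simp add: B_def power_mult_distrib power_divide)
    finally show ?thesis using \<rho> by (simp add: pos_le_divide_eq mult.commute)
  qed
  moreover have "(\<lambda>t. B * ((c1 + c2 * real t ^ d)\<^sup>2 / \<rho> ^ t)) \<longlonglongrightarrow> B * 0"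
    by (intro tendsto_mult tendsto_const poly_over_exponential \<rho>)
  ultimately have "\<bar>qform n S x\<bar> \<le> B * 0"
    by (intro LIMSEQ_le_const[where X = "\<lambda>t. B * ((c1 + c2 * real t ^ d)\<^sup>2 / \<rho> ^ t)"]) auto
  then show False using neg by simp
qed

text \<open>The Jacobian leaves the space of directions \<open>u x^T\<close> invariant and acts on
  \<open>x\<close> as one sweep for the slack matrix. Non-optimality makes that matrix indefinite
  enough to provide an \<open>x\<close> with negative form, from which the growth starts.\<close>

lemma rank_deficient_nonoptimal_unstable:
  assumes sym: "\<And>i j. C i j = C j i" and diag: "\<And>i. C i i = 0"
    and crit: "first_order_critical n k C V" and nondeg: "nondegenerate n k C V"
    and nonopt: "\<not> sdp_optimal n C (gram k V)"
    and u: "a < k" "u a \<noteq> 0" "\<And>j. j < n \<Longrightarrow> (\<Sum>a<k. u a * V a j) = 0"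
  shows "unstable_fixed_point n k C V"
proof -
  let ?y = "gnorm n k C V" and ?S = "dual_slack n k C V"
  let ?G = "gs_partial n C ?y n" and ?J = "mixing_jacobian n k C V"
  obtain \<delta> where \<delta>: "\<delta> > 0" "\<And>i. i < n \<Longrightarrow> ?y i \<ge> \<delta>"
    using nondegenerate_gnorm_ge[OF crit nondeg] by blast
  then have pos: "\<And>i. i < n \<Longrightarrow> ?y i > 0" by force
  have S: "\<And>i j. ?S i j = C i j + (if i = j then ?y i else 0)" by (simp add: dual_slack_def)
  have "\<not> psd n ?S" using critical_psd_slack_optimal[OF crit] nonopt by blast
  moreover have "\<forall>i<n. \<forall>j<n. ?S i j = ?S j i" using sym by (auto simp: dual_slack_def)
  ultimately obtain x where x: "qform n ?S x < 0"
    unfolding psd_def qform_def by (meson not_le)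
  obtain \<rho> where \<rho>: "\<rho> > 1" "\<And>t. qform n ?S ((?G ^^ t) x) \<le> \<rho> ^ t * qform n ?S x"
    using gs_geometric_growth[of C ?S ?y, OF sym diag S \<delta> x] by blast
  obtain d where der: "\<And>b j a i. a < k \<Longrightarrow> i < n \<Longrightarrow>
        ((\<lambda>t. mixing_map n k C (perturb V b j t) a i) has_real_derivative d b j a i) (at 0)"
    and lin: "\<And>a i x. a < k \<Longrightarrow> i < n \<Longrightarrow> (\<Sum>b<k. \<Sum>j<n. d b j a i * (u b * x j)) = u a * ?G x i"
    using mix_partial_linearization[OF crit pos u(3), of n] unfolding mixing_map_def by blast
  \<comment> \<open>Position \<open>b * n + j\<close> holds \<open>u b * x j\<close>, the ordering
    of coordinates used in \<open>mixing_jacobian\<close>.\<close>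
  define z where "z x = Matrix.vec (k * n) (\<lambda>q. complex_of_real (u (q div n) * x (q mod n)))" for x
  have J: "?J \<in> carrier_mat (k * n) (k * n)" by (simp add: mixing_jacobian_def)
  have idx: "p div n < k" "p mod n < n" if "p < k * n" for p
  proof -
    show "p div n < k" using that by (simp add: less_mult_imp_div_less)
    have "n > 0" using that by (cases n) auto
    then show "p mod n < n" by simp
  qed
  have Jpq: "?J $$ (p, q) = d (q div n) (q mod n) (p div n) (p mod n)" if "p < k * n" "q < k * n" for p q
    using that DERIV_imp_deriv[OF der[OF idx[OF that(1)]]] by (simp add: mixing_jacobian_def)
  have Jz: "map_mat complex_of_real ?J *\<^sub>v z x = z (?G x)" for x
  proof (rule eq_vecI)
    fix p assume "p < dim_vec (z (?G x))"
    then have p: "p < k * n" by (simp add: z_def)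
    have "(map_mat complex_of_real ?J *\<^sub>v z x) $ p
        = (\<Sum>q<k * n. complex_of_real (?J $$ (p, q)) * complex_of_real (u (q div n) * x (q mod n)))"
      using J p by (simp add: z_def scalar_prod_def atLeast0LessThan)
    also have "\<dots> = complex_of_real (\<Sum>q<k * n. d (q div n) (q mod n) (p div n) (p mod n) * (u (q div n) * x (q mod n)))"
      using p by (simp add: Jpq)
    also have "\<dots> = complex_of_real (u (p div n) * ?G x (p mod n))"
      unfolding sum_div_mod[of "\<lambda>b j. d b j (p div n) (p mod n) * (u b * x j)"] lin[OF idx[OF p]] ..
    finally show "(map_mat complex_of_real ?J *\<^sub>v z x) $ p = z (?G x) $ p"
      using p by (simp add: z_def)
  qed (use J in \<open>simp add: z_def\<close>)
  have ai: "a * n + i < k * n" if "i < n" for i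
  proof -
    have "a * n + i < Suc a * n" using that by simp
    also have "\<dots> \<le> k * n" using u(1) by (intro mult_le_mono1) simp
    finally show ?thesis .
  qed
  have "spectral_radius (map_mat complex_of_real ?J) > 1"
  \<comment> \<open>The block of row \<open>a\<close>, where \<open>u a\<close> is nonzero,
    reproduces \<open>x\<close> scaled by \<open>u a\<close>.\<close>
  proof (rule spectral_radius_gt_1_if_growth[where z = z and G = ?G and p = "\<lambda>i. a * n + i" and c = "\<bar>u a\<bar>"])
    show "norm (z x $ (a * n + i)) = \<bar>u a\<bar> * \<bar>x i\<bar>" if "i < n" for x i
      using ai[OF that] that by (simp add: z_def norm_mult)
  qed (use J Jz ai u(2) \<rho> x in \<open>auto simp: z_def\<close>)
  moreover have "mixing_map n k C V = V"
    unfolding mixing_map_def by (rule mix_partial_critical[OF crit pos]) auto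
  ultimately show ?thesis by (simp add: unstable_fixed_point_def)
qed

theorem theorem2:
  fixes n k :: nat
  assumes "real k > sqrt (2 * real n)"
  shows "AE A in PiM (upper_idx n) (\<lambda>_. lborel).
           \<forall>V. first_order_critical n k (sym_cost A) V
               \<and> nondegenerate n k (sym_cost A) V
               \<and> \<not> sdp_optimal n (sym_cost A) (gram k V)
             \<longrightarrow> unstable_fixed_point n k (sym_cost A) V"
proof -
  have "(sqrt (2 * real n))\<^sup>2 < (real k)\<^sup>2"
    using assms by (intro power_strict_mono) auto
  then have "real (2 * n) < real (k * k)" by (simp add: power2_eq_square)
  then have "2 * n < k * k + k" by linarith
  from generic_rank_deficient[OF this] show ?thesis
  proof eventually_elim
    case (elim A)
    show ?case
    proof (intro allI impI, elim conjE)
      fix V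
      assume V: "first_order_critical n k (sym_cost A) V" "nondegenerate n k (sym_cost A) V"
        "\<not> sdp_optimal n (sym_cost A) (gram k V)"
      with elim obtain u a where "a < k" "u a \<noteq> 0" "\<And>j. j < n \<Longrightarrow> (\<Sum>a<k. u a * V a j) = 0"
        by blast
      then show "unstable_fixed_point n k (sym_cost A) V"
        using V by (intro rank_deficient_nonoptimal_unstable[where C = "sym_cost A"])
          (auto simp: sym_cost_sym sym_cost_def[of _ i i for i])
    qed
  qed
qed

end
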